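(* Let $k \geq 3$ be an integer and let $g \geq 5$ be an odd integer. Let $G$ be a $(k;g)$-cage. Then every cycle of length $g$ in $G$ is nonseparating, i.e. for every cycle $C$ of length $g$ in $G$, the graph $G - V(C)$ is connected.
   Context: All graphs are finite and simple. The girth of a graph is the length of a shortest cycle in it. A $(k;g)$-graph is a $k$-regular graph with girth $g$, and a $(k;g)$-cage is a $(k;g)$-graph of minimum order (minimum number of vertices) among all $(k;g)$-graphs. A cycle $C$ in a graph $G$ is nonseparating if $G - V(C)$ (the graph obtained by deleting the vertices of $C$) is connected. *)

theory Defs
  imports "Graph_Theory.Graph_Theory" "HOL-Library.Extended_Nat"
begin

text \<open>
  Finite simple graphs are \<^locale>\<open>pair_graph\<close>s: finite symmetric loopfree digraphs whose arcs are
  ordered pairs of vertices, an undirected edge \<open>{u, v}\<close> being the two arcs \<open>(u, v)\<close>, \<open>(v, u)\<close>.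
\<close>

text \<open>
  \<^const>\<open>pre_digraph.cycle\<close> also accepts \<open>u, v, u\<close>; the length bound excludes this traversal of a
  single edge back and forth.
\<close>

definition simple_cycle :: "'a pair_pre_digraph \<Rightarrow> ('a \<times> 'a) list \<Rightarrow> bool" where
  "simple_cycle G p \<longleftrightarrow> pre_digraph.cycle (with_proj G) p \<and> 3 \<le> length p"

text \<open>For a nonempty walk \<open>p\<close>, \<^const>\<open>pre_digraph.awalk_verts\<close> does not depend on its vertex argument.\<close>

definition cycle_verts :: "'a pair_pre_digraph \<Rightarrow> ('a \<times> 'a) list \<Rightarrow> 'a set" where
  "cycle_verts G p = set (pre_digraph.awalk_verts (with_proj G) (fst (hd p)) p)"

text \<open>The girth of an acyclic graph is \<open>\<infinity>\<close>.\<close>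

definition girth :: "'a pair_pre_digraph \<Rightarrow> enat" where
  "girth G = (INF p \<in> {p. simple_cycle G p}. enat (length p))"

definition regular_graph :: "nat \<Rightarrow> 'a pair_pre_digraph \<Rightarrow> bool" where
  "regular_graph k G \<longleftrightarrow> (\<forall>v \<in> pverts G. out_degree (with_proj G) v = k)"

definition kg_graph :: "nat \<Rightarrow> nat \<Rightarrow> 'a pair_pre_digraph \<Rightarrow> bool" where
  "kg_graph k g G \<longleftrightarrow> pair_graph G \<and> regular_graph k G \<and> girth G = enat g"

text \<open>
  The competitors \<open>H\<close> have vertices in \<^typ>\<open>nat\<close>, which has room for an isomorphic copy of every finite
  graph; the vertex type of \<open>G\<close> itself might be too small.
\<close>

definition kg_cage :: "nat \<Rightarrow> nat \<Rightarrow> 'a pair_pre_digraph \<Rightarrow> bool" where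
  "kg_cage k g G \<longleftrightarrow> kg_graph k g G \<and>
     (\<forall>H :: nat pair_pre_digraph. kg_graph k g H \<longrightarrow> card (pverts G) \<le> card (pverts H))"

definition nonseparating :: "'a pair_pre_digraph \<Rightarrow> ('a \<times> 'a) list \<Rightarrow> bool" where
  "nonseparating G p \<longleftrightarrow> connected (with_proj G \<restriction> (pverts G - cycle_verts G p))"

end

theory Submission
  imports Defs
begin

text \<open>
  Let \<open>g = 2r + 1\<close> and let \<open>C\<close> be a separating \<open>g\<close>-cycle of the cage \<open>G\<close>. Let \<open>A\<close> be a nonempty union of
  components of \<open>G - C\<close> with at most half of the vertices of \<open>G - C\<close>. Every vertex of \<open>A\<close> has at most
  one neighbour on \<open>C\<close>; let \<open>D\<close> be the set of those that have one. Two copies of \<open>A\<close>, joined by the edges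
  from \<open>x\<close> to the copy of \<open>\<phi> x\<close> for a permutation \<open>\<phi>\<close> of \<open>D\<close>, form a \<open>k\<close>-regular graph smaller than \<open>G\<close>,
  and since a \<open>k\<close>-regular graph of minimum order among those of girth at least \<open>g\<close> has girth exactly \<open>g\<close>,
  its girth must be less than \<open>g\<close>.

  Distances in \<open>A\<close> between distinct vertices of \<open>D\<close> are at least \<open>r - 1\<close>, so the girth drops only if \<open>\<phi>\<close> maps
  a pair at distance exactly \<open>r - 1\<close> to another one. Such pairs have antipodal neighbours on \<open>C\<close>, and
  a vertex of \<open>D\<close> is in at most one such pair for each of the two antipodes. The graph they form on \<open>D\<close>
  hence consists of paths and of cycles winding around \<open>\<int>/g\<close>, and it can be packed with itself if \<open>D\<close> has
  at least four elements. If \<open>D\<close> has at most three elements and cannot be packed, some closed walk of length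
  \<open>g\<close> runs through \<open>D\<close> and separates a smaller part of \<open>A\<close>, and one concludes by descent on the size of \<open>A\<close>.
\<close>

section \<open>Cycles, girth and walks\<close>

text \<open>
  Cycles are represented by periodic functions on \<open>nat\<close>, so that rotating a cycle needs no arithmetic.
\<close>

definition cyc :: "'v rel \<Rightarrow> (nat \<Rightarrow> 'v) \<Rightarrow> nat \<Rightarrow> bool" where
  "cyc E c m \<longleftrightarrow> 3 \<le> m \<and> (\<forall>i. (c i, c (Suc i)) \<in> E) \<and> (\<forall>i j. c i = c j \<longleftrightarrow> i mod m = j mod m)"

definition girth_ge :: "'v rel \<Rightarrow> nat \<Rightarrow> bool" where
  "girth_ge E g \<longleftrightarrow> (\<forall>c m. cyc E c m \<longrightarrow> g \<le> m)"

text \<open>Only a lower bound on the girth is imposed, because that is what gluing preserves.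
  \<open>smaller_girth_smaller_order\<close> recovers the exact girth for graphs of minimum
  order.\<close>

definition kgraph :: "nat \<Rightarrow> nat \<Rightarrow> 'v set \<Rightarrow> 'v rel \<Rightarrow> bool" where
  "kgraph k g V E \<longleftrightarrow> finite V \<and> E \<subseteq> V \<times> V \<and> sym E \<and> irrefl E \<and>
     (\<forall>v \<in> V. card (E `` {v}) = k) \<and> girth_ge E g"

lemma cyc_mono: "cyc E c m \<Longrightarrow> E \<subseteq> F \<Longrightarrow> cyc F c m"
  unfolding cyc_def by blast

lemma girth_ge_antimono: "girth_ge F g \<Longrightarrow> E \<subseteq> F \<Longrightarrow> girth_ge E g"
  unfolding girth_ge_def using cyc_mono by blast

lemma girth_ge_le: "girth_ge E h \<Longrightarrow> g \<le> h \<Longrightarrow> girth_ge E g"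
  unfolding girth_ge_def using order_trans by blast

lemma relpow_sym:
  assumes "sym R" "(a, b) \<in> R ^^ n" shows "(b, a) \<in> R ^^ n"
  using assms(2)
proof (induction n arbitrary: b)
  case (Suc n)
  then obtain z where "(a, z) \<in> R ^^ n" "(z, b) \<in> R" by auto
  with Suc.IH[of z] \<open>sym R\<close> show ?case
    by (meson relpow_Suc_I2 symD)
qed simp

lemma relpow_mono_rel:
  fixes R S :: "'v rel"
  assumes "(a, b) \<in> R ^^ n" "R \<subseteq> S" shows "(a, b) \<in> S ^^ n"
  using assms(1)
proof (induction n arbitrary: b)
  case (Suc n)
  from Suc.prems obtain z where "(a, z) \<in> R ^^ n" "(z, b) \<in> R" by auto
  with Suc.IH assms(2) show ?case by auto
qed simp

lemma walk_append: "(a, b) \<in> R ^^ m \<Longrightarrow> (b, c) \<in> R ^^ n \<Longrightarrow> (a, c) \<in> R ^^ (m + n)"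
  by (auto simp: relpow_add)

lemma walk_segment:
  assumes "\<And>i. i < n \<Longrightarrow> (f (s + i), f (Suc (s + i))) \<in> R"
  shows "(f s, f (s + n)) \<in> R ^^ n"
  unfolding relpow_fun_conv using assms by (intro exI[of _ "\<lambda>i. f (s + i)"]) auto

text \<open>A shortest walk from \<open>b\<close> to \<open>a\<close> that avoids the edge repeats
  no vertex, so the edge closes it to a cycle of length at most \<open>n + 1\<close>. Since
  \<open>n\<close> is the length of an arbitrary walk, later arguments need not check that their
  walks are paths.\<close>

lemma edge_walk_bound:
  assumes g: "girth_ge E g" and ab: "(a, b) \<in> E" "a \<noteq> b"
    and w: "(b, a) \<in> (E - {(a, b), (b, a)}) ^^ n"
  shows "g \<le> n + 1"
proof -
  define F where "F = E - {(a, b), (b, a)}"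
  define l where "l = (LEAST l. (b, a) \<in> F ^^ l)"
  have l: "(b, a) \<in> F ^^ l" unfolding l_def using w F_def by (metis LeastI)
  have ln: "l \<le> n" unfolding l_def using w F_def by (auto intro: Least_le)
  have lmin: "l \<le> j" if "(b, a) \<in> F ^^ j" for j unfolding l_def using that by (rule Least_le)
  obtain f where f: "f 0 = b" "f l = a" "\<And>i. i < l \<Longrightarrow> (f i, f (Suc i)) \<in> F"
    using l unfolding relpow_fun_conv by blast
  have seg: "(f i, f j) \<in> F ^^ (j - i)" if "i \<le> j" "j \<le> l" for i j
    using walk_segment[of "j - i" f i F] f(3) that by auto
  have inj: "i = j" if "i \<le> j" "j \<le> l" "f i = f j" for i j
  proof -
    have "(b, f i) \<in> F ^^ i" using seg[of 0 i] f that by auto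
    moreover have "(f j, a) \<in> F ^^ (l - j)" using seg[of j l] f that by auto
    ultimately have "(b, a) \<in> F ^^ (i + (l - j))" using that(3) walk_append by metis
    with lmin that show ?thesis by fastforce
  qed
  have "l \<noteq> 0" using f ab by (metis)
  moreover have "l \<noteq> 1" using f F_def by (metis DiffD2 One_nat_def insertI1 insertI2 lessI)
  ultimately have l2: "2 \<le> l" by linarith
  \<comment> \<open>The walk has the \<open>Suc l\<close> vertices \<open>f 0\<close>, ...,
    \<open>f l\<close>; the step that wraps around from index \<open>l\<close> to index
    \<open>0\<close> is the edge \<open>(a, b)\<close>.\<close>
  define c where "c = (\<lambda>i. f (i mod Suc l))"
  have "cyc E c (Suc l)"
    unfolding cyc_def
  proof (intro conjI allI)
    show "3 \<le> Suc l" using l2 by simp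
    fix i
    show "(c i, c (Suc i)) \<in> E"
    proof (cases "i mod Suc l = l")
      case True
      then have "Suc i mod Suc l = 0" by (metis mod_Suc)
      then show ?thesis using True f ab by (simp add: c_def)
    next
      case False
      then have "i mod Suc l < l" by (metis less_Suc_eq mod_less_divisor zero_less_Suc)
      moreover have "Suc i mod Suc l = Suc (i mod Suc l)" using False by (simp add: mod_Suc)
      ultimately show ?thesis using f(3) by (auto simp: c_def F_def)
    qed
    fix j
    have "i mod Suc l \<le> l" "j mod Suc l \<le> l" by (simp_all add: less_Suc_eq_le[symmetric])
    then show "(c i = c j) = (i mod Suc l = j mod Suc l)"
      unfolding c_def using inj[of "i mod Suc l" "j mod Suc l"] inj[of "j mod Suc l" "i mod Suc l"]
      by (cases "i mod Suc l \<le> j mod Suc l") auto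
  qed
  then have "g \<le> Suc l" using g unfolding girth_ge_def by blast
  with ln show ?thesis by simp
qed

text \<open>
  The two walks may have length 0 or repeat vertices; as \<open>A\<close> and \<open>B\<close> are disjoint, neither uses the
  edge \<open>{x, p}\<close>.
\<close>

lemma two_walks_bound:
  assumes g: "girth_ge E g" and symE: "sym E" and disj: "A \<inter> B = {}"
    and w1: "(x, y) \<in> (E \<inter> A \<times> A) ^^ d" and w2: "(p, q) \<in> (E \<inter> B \<times> B) ^^ e"
    and mem: "x \<in> A" "y \<in> A" "p \<in> B" "q \<in> B"
    and xp: "(x, p) \<in> E" and yq: "(y, q) \<in> E" and ne: "(x, p) \<noteq> (y, q)"
  shows "g \<le> d + e + 2"
proof -
  let ?F = "E - {(x, p), (p, x)}"
  have "x \<noteq> p" using mem disj by auto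
  have pq: "(p, q) \<in> ?F ^^ e" using w2 by (rule relpow_mono_rel) (use mem disj in auto)
  have qy: "(q, y) \<in> ?F ^^ 1"
  proof -
    have "(q, y) \<in> E" using symD[OF symE yq] .
    moreover have "(q, y) \<noteq> (x, p)" "(q, y) \<noteq> (p, x)" using mem disj ne by blast+
    ultimately show ?thesis by simp
  qed
  have yx: "(y, x) \<in> ?F ^^ d"
  proof -
    have "sym (E \<inter> A \<times> A)" using symE by (auto simp: sym_def)
    then have "(y, x) \<in> (E \<inter> A \<times> A) ^^ d" using w1 relpow_sym by metis
    then show ?thesis by (rule relpow_mono_rel) (use mem disj in auto)
  qed
  from edge_walk_bound[OF g xp \<open>x \<noteq> p\<close> walk_append[OF walk_append[OF pq qy] yx]] show ?thesis by simp
qed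

text \<open>Cuts a cycle at its \<open>M\<close>-edges. The same edge recurs after \<open>m\<close>
  steps, so a next one exists. Two consecutive \<open>M\<close>-edges would return to the vertex
  before, since \<open>M\<close> is a symmetric partial function, and this is impossible on a cycle;
  hence \<open>1 \<le> n\<close>.\<close>

lemma next_matching_edge:
  assumes c: "cyc (E0 \<union> M) c m" and M: "(c i, c (Suc i)) \<in> M"
    and symM: "sym M" and funM: "single_valued M"
  obtains n where "1 \<le> n" "n < m" "(c (Suc i), c (Suc i + n)) \<in> E0 ^^ n"
    "(c (Suc i + n), c (Suc (Suc i + n))) \<in> M"
    "\<And>j. i < j \<Longrightarrow> (c j, c (Suc j)) \<in> M \<Longrightarrow> Suc i + n \<le> j"
    "c (Suc i) \<noteq> c (Suc i + n)"
proof -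
  have m3: "3 \<le> m" and cE: "\<And>i. (c i, c (Suc i)) \<in> E0 \<union> M"
    and inj: "\<And>i j. c i = c j \<longleftrightarrow> i mod m = j mod m"
    using c unfolding cyc_def by auto
  let ?P = "\<lambda>n. (c (Suc i + n), c (Suc (Suc i + n))) \<in> M"
  define n where "n = (LEAST n. ?P n)"
  have "c (Suc i + (m - 1)) = c i" "c (Suc (Suc i + (m - 1))) = c (Suc i)"
  proof -
    have "Suc i + (m - 1) = i + m" "Suc (Suc i + (m - 1)) = Suc i + m" using m3 by simp_all
    then show "c (Suc i + (m - 1)) = c i" "c (Suc (Suc i + (m - 1))) = c (Suc i)"
      unfolding inj by (metis mod_add_self2)+
  qed
  then have P: "?P (m - 1)" using M by simp
  have n: "?P n" unfolding n_def using P by (rule LeastI)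
  have nm: "n \<le> m - 1" unfolding n_def using P by (rule Least_le)
  have least: "n \<le> j" if "?P j" for j unfolding n_def using that by (rule Least_le)
  have "n \<noteq> 0"
  proof
    assume "n = 0"
    then have "(c (Suc i), c (Suc (Suc i))) \<in> M" using n by simp
    moreover have "(c (Suc i), c i) \<in> M" using M symM by (meson symD)
    ultimately have "c (Suc (Suc i)) = c i" using funM by (meson single_valuedD)
    then have "(i + 2) mod m = i mod m" unfolding inj by simp
    then have "m dvd 2" using mod_eq_dvd_iff_nat[of i "i + 2" m] by simp
    with m3 show False by (auto dest: dvd_imp_le)
  qed
  moreover have "(c (Suc i), c (Suc i + n)) \<in> E0 ^^ n"
  proof (rule walk_segment)
    fix j assume "j < n"
    then have "\<not> ?P j" using least by force
    then show "(c (Suc i + j), c (Suc (Suc i + j))) \<in> E0" using cE by blast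
  qed
  moreover have "Suc i + n \<le> j" if "i < j" "(c j, c (Suc j)) \<in> M" for j
    using least[of "j - Suc i"] that by (simp add: Suc_le_eq)
  moreover have "c (Suc i) \<noteq> c (Suc i + n)"
  proof
    assume "c (Suc i) = c (Suc i + n)"
    then have "(Suc i + n) mod m = Suc i mod m" unfolding inj by simp
    then have "m dvd n" using mod_eq_dvd_iff_nat[of "Suc i" "Suc i + n" m] by simp
    with \<open>n \<noteq> 0\<close> nm m3 show False by (auto dest: dvd_imp_le)
  qed
  ultimately show ?thesis using that[of n] n nm m3 by simp
qed

text \<open>Counts the \<open>M\<close>-edges in one period of a cycle. Without any, the cycle lies
  in \<open>E0\<close>; one and two are covered by \<open>one\<close> and \<open>two\<close>; three
  or more leave three stretches of length at least \<open>s\<close> besides three edges of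
  \<open>M\<close>.\<close>

lemma girth_ge_matching:
  assumes E0: "girth_ge E0 g" and symM: "sym M"
    and funM: "single_valued M"
    and one: "\<And>p q d. (p, q) \<in> M \<Longrightarrow> (q, p) \<in> E0 ^^ d \<Longrightarrow> g \<le> d + 1"
    and two: "\<And>p q p' q' d d'. (p, q) \<in> M \<Longrightarrow> (p', q') \<in> M \<Longrightarrow> q \<noteq> p' \<Longrightarrow> q' \<noteq> p \<Longrightarrow>
      (q, p') \<in> E0 ^^ d \<Longrightarrow> (q', p) \<in> E0 ^^ d' \<Longrightarrow> g \<le> d + d' + 2"
    and three: "\<And>p q d. p \<in> Domain M \<Longrightarrow> q \<in> Domain M \<Longrightarrow> p \<noteq> q \<Longrightarrow> (p, q) \<in> E0 ^^ d \<Longrightarrow> s \<le> d"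
    and s: "g \<le> 3 * s + 3"
  shows "girth_ge (E0 \<union> M) g"
  unfolding girth_ge_def
proof (intro allI impI)
  fix c m assume c: "cyc (E0 \<union> M) c m"
  show "g \<le> m"
  proof (cases "\<exists>i. (c i, c (Suc i)) \<in> M")
    case False
    then have "cyc E0 c m" using c unfolding cyc_def by blast
    then show ?thesis using E0 unfolding girth_ge_def by blast
  next
    case True
    then obtain i where i: "(c i, c (Suc i)) \<in> M" by blast
    have inj: "c i = c j \<longleftrightarrow> i mod m = j mod m" for i j
      using c unfolding cyc_def by blast
    have per: "c (j + m) = c j" "c (Suc (j + m)) = c (Suc j)" for j
      unfolding inj by (simp_all del: add_Suc add: add_Suc[symmetric])
    have mi: "(c (i + m), c (Suc (i + m))) \<in> M" using i per by simp
    have m3: "3 \<le> m" using c unfolding cyc_def by simp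
    have dom: "a \<in> Domain M" "b \<in> Domain M" if "(a, b) \<in> M" for a b
      using that symM by (auto dest: symD)
    obtain n1 where n1: "(c (Suc i), c (Suc i + n1)) \<in> E0 ^^ n1" "(c (Suc i + n1), c (Suc (Suc i + n1))) \<in> M"
      "\<And>j. i < j \<Longrightarrow> (c j, c (Suc j)) \<in> M \<Longrightarrow> Suc i + n1 \<le> j" "c (Suc i) \<noteq> c (Suc i + n1)"
      using next_matching_edge[OF c i symM funM] by metis
    have le1: "Suc i + n1 \<le> i + m" using n1(3)[OF _ mi] m3 by simp
    \<comment> \<open>Equality means that the next edge of \<open>M\<close> is the first one again,
      a period later, so the cycle contains exactly one.\<close>
    show ?thesis
    proof (cases "Suc i + n1 = i + m")
      case True
      then have "(c (Suc i), c i) \<in> E0 ^^ n1" using n1(1) per by metis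
      from one[OF i this] show ?thesis using True by simp
    next
      case False
      define i1 where "i1 = Suc i + n1"
      have i1: "(c i1, c (Suc i1)) \<in> M" using n1 i1_def by simp
      obtain n2 where n2: "(c (Suc i1), c (Suc i1 + n2)) \<in> E0 ^^ n2" "(c (Suc i1 + n2), c (Suc (Suc i1 + n2))) \<in> M"
        "\<And>j. i1 < j \<Longrightarrow> (c j, c (Suc j)) \<in> M \<Longrightarrow> Suc i1 + n2 \<le> j" "c (Suc i1) \<noteq> c (Suc i1 + n2)"
        using next_matching_edge[OF c i1 symM funM] by metis
      have le2: "Suc i1 + n2 \<le> i + m" using n2(3)[OF _ mi] le1 False i1_def by simp
      show ?thesis
      proof (cases "Suc i1 + n2 = i + m")
        case True
        then have *: "(c (Suc i1), c i) \<in> E0 ^^ n2" "c (Suc i1) \<noteq> c i" using n2 per by metis+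
        have "g \<le> n1 + n2 + 2"
          using two[OF i i1 _ *(2) _ *(1)] n1 i1_def by simp
        then show ?thesis using True i1_def by simp
      next
        case False
        define i2 where "i2 = Suc i1 + n2"
        have i2: "(c i2, c (Suc i2)) \<in> M" using n2 i2_def by simp
        obtain n3 where n3: "(c (Suc i2), c (Suc i2 + n3)) \<in> E0 ^^ n3" "(c (Suc i2 + n3), c (Suc (Suc i2 + n3))) \<in> M"
          "\<And>j. i2 < j \<Longrightarrow> (c j, c (Suc j)) \<in> M \<Longrightarrow> Suc i2 + n3 \<le> j" "c (Suc i2) \<noteq> c (Suc i2 + n3)"
          using next_matching_edge[OF c i2 symM funM] by metis
        have le3: "Suc i2 + n3 \<le> i + m" using n3(3)[OF _ mi] le2 False i2_def by simp
        have "s \<le> n1" using three[OF dom(2)[OF i] dom(1)[OF n1(2)] n1(4,1)] .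
        moreover have "s \<le> n2" using three[OF dom(2)[OF i1] dom(1)[OF n2(2)] n2(4,1)] .
        moreover have "s \<le> n3" using three[OF dom(2)[OF i2] dom(1)[OF n3(2)] n3(4,1)] .
        ultimately show ?thesis using le3 s i2_def i1_def by simp
      qed
    qed
  qed
qed

section \<open>Girth monotonicity\<close>

lemma fixpoint_free_involution:
  assumes "finite S" "even (card S)"
  shows "\<exists>h. \<forall>x\<in>S. h x \<in> S \<and> h x \<noteq> x \<and> h (h x) = x"
  using assms
proof (induction "card S" arbitrary: S rule: less_induct)
  case less
  show ?case
  proof (cases "S = {}")
    case False
    then obtain a where a: "a \<in> S" by blast
    have "S \<noteq> {a}" using less.prems by auto
    then obtain b where b: "b \<in> S" "b \<noteq> a" using a by blast
    let ?T = "S - {a, b}"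
    have "card S = card ?T + 2"
      using a b less.prems(1) card_Diff_subset[of "{a, b}" S] card_mono[of S "{a, b}"] by auto
    then obtain h where h: "\<forall>x\<in>?T. h x \<in> ?T \<and> h x \<noteq> x \<and> h (h x) = x"
      using less.hyps[of ?T] less.prems by auto
    let ?h = "h(a := b, b := a)"
    have "?h x \<in> S \<and> ?h x \<noteq> x \<and> ?h (?h x) = x" if "x \<in> S" for x
      using h that a b by (cases "x = a"; cases "x = b") auto
    then show ?thesis by blast
  qed simp
qed

text \<open>\<open>X\<close> will be a vertex or the two ends of an edge. Each remaining neighbour
  of \<open>X\<close> loses one edge and is paired with another neighbour of the same deleted vertex
  \<open>v\<close>. A new edge replaces a path of length two through \<open>v\<close>, so a cycle
  with one new edge shortens by only one; with more new edges, the neighbours are at distance at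
  least \<open>g - 2\<close>, which suffices.\<close>

lemma delete_clique_and_match:
  assumes G: "kgraph k (Suc g) V E" and k: "3 \<le> k" and g: "3 \<le> g"
    and X: "X \<subseteq> V" "X \<noteq> {}" "card X \<le> 2"
    and clique: "\<And>p q. p \<in> X \<Longrightarrow> q \<in> X \<Longrightarrow> p \<noteq> q \<Longrightarrow> (p, q) \<in> E"
    and ev: "\<And>v. v \<in> X \<Longrightarrow> even (card (E `` {v} - X))"
  shows "\<exists>V' E' :: 'v rel. kgraph k g V' E' \<and> V' \<noteq> {} \<and> card V' < card (V :: 'v set)"
proof -
  have fin: "finite V" and EV: "E \<subseteq> V \<times> V" and symE: "sym E" and irr: "irrefl E"
    and deg: "\<And>v. v \<in> V \<Longrightarrow> card (E `` {v}) = k" and girth: "girth_ge E (Suc g)"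
    using G unfolding kgraph_def by auto
  define S where "S = (\<lambda>v. E `` {v} - X)"
  have finE: "finite (E `` {v})" for v using EV fin by (auto intro: finite_subset)
  have "\<forall>v\<in>X. \<exists>h. \<forall>x\<in>S v. h x \<in> S v \<and> h x \<noteq> x \<and> h (h x) = x"
    unfolding S_def by (intro ballI fixpoint_free_involution finite_Diff finE ev)
  then obtain h where h: "\<And>v x. v \<in> X \<Longrightarrow> x \<in> S v \<Longrightarrow> h v x \<in> S v \<and> h v x \<noteq> x \<and> h v (h v x) = x"
    by metis
  define W where "W = V - X"
  define E0 where "E0 = E \<inter> W \<times> W"
  define M where "M = {(x, h v x) | v x. v \<in> X \<and> x \<in> S v}"
  have SW: "S v \<subseteq> W" for v using EV by (auto simp: S_def W_def)
  \<comment> \<open>A walk outside \<open>X\<close> between neighbours of \<open>v\<close> and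
    \<open>w\<close> closes up through \<open>X\<close>, either at \<open>v = w\<close> or along the
    edge from \<open>v\<close> to \<open>w\<close>.\<close>
  have bound: "Suc g \<le> d + (if v = w then 0 else 1) + 2"
    if "v \<in> X" "w \<in> X" "p \<in> S v" "q \<in> S w" "(p, v) \<noteq> (q, w)" "(p, q) \<in> E0 ^^ d" for v w p q d
  proof (rule two_walks_bound[OF girth symE, of W X p q d v w])
    show "(v, w) \<in> (E \<inter> X \<times> X) ^^ (if v = w then 0 else 1)" using clique that by auto
  qed (use that SW symD[OF symE] in \<open>auto simp: S_def W_def E0_def\<close>)
  \<comment> \<open>A common neighbour of two vertices of \<open>X\<close> would form a triangle
    with them.\<close>
  have uniq: "v = w" if "v \<in> X" "w \<in> X" "x \<in> S v" "x \<in> S w" for v w x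
    using bound[of v w x x 0] that g by (auto split: if_splits)
  have symM: "sym M" unfolding sym_def M_def using h by (auto, metis)
  have svM: "single_valued M" unfolding single_valued_def M_def using uniq by blast
  have domM: "\<exists>v\<in>X. p \<in> S v" if "p \<in> Domain M" for p using that by (auto simp: M_def)
  have far: "g - 2 \<le> d" if pq: "p \<in> Domain M" "q \<in> Domain M" "p \<noteq> q" "(p, q) \<in> E0 ^^ d" for p q d
  proof -
    obtain v w where "v \<in> X" "p \<in> S v" "w \<in> X" "q \<in> S w" using domM pq by meson
    from bound[of v w p q d] this pq show ?thesis by (auto split: if_splits)
  qed
  have dom: "p \<in> Domain M \<and> q \<in> Domain M" if "(p, q) \<in> M" for p q
    using that symM by (auto dest: symD)
  have "girth_ge (E0 \<union> M) g"
  proof (rule girth_ge_matching[OF _ symM svM, where s = "g - 2"])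
    show "girth_ge E0 g"
      using girth by (rule girth_ge_le[OF girth_ge_antimono]) (auto simp: E0_def)
    show "g \<le> 3 * (g - 2) + 3" using g by simp
  next
    fix p q d assume M: "(p, q) \<in> M" and w: "(q, p) \<in> E0 ^^ d"
    obtain v where v: "v \<in> X" "p \<in> S v" "q = h v p" using M by (auto simp: M_def)
    with bound[of v v q p d] h[of v p] w show "g \<le> d + 1" by auto
  next
    fix p q p' q' d d'
    assume "(p, q) \<in> M" "(p', q') \<in> M" "q \<noteq> p'" "q' \<noteq> p" "(q, p') \<in> E0 ^^ d" "(q', p) \<in> E0 ^^ d'"
    with far[of q p' d] far[of q' p d'] dom g show "g \<le> d + d' + 2" by fastforce
  qed (use far in auto)
  moreover have "card ((E0 \<union> M) `` {x}) = k" if x: "x \<in> W" for x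
  proof (cases "\<exists>v\<in>X. x \<in> S v")
    case True
    then obtain v where v: "v \<in> X" "x \<in> S v" by blast
    have Mx: "M `` {x} = {h v x}" using v uniq by (auto simp: M_def)
    have "w = v" if "w \<in> X" "(x, w) \<in> E" for w
      using uniq[of w v x] v that symD[OF symE that(2)] x by (auto simp: S_def W_def)
    moreover have xv: "(x, v) \<in> E" "v \<notin> W" using v symD[OF symE, of v x] by (auto simp: S_def W_def)
    ultimately have "E0 `` {x} = E `` {x} - {v}"
      using x EV by (auto simp: E0_def W_def)
    then have "card (E0 `` {x}) = k - 1"
      using deg[of x] x finE[of x] xv by (simp add: W_def)
    \<comment> \<open>If \<open>x\<close> and \<open>h v x\<close> were already adjacent, they would
      form a triangle with \<open>v\<close>; so the matching edge restores the degree.\<close>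
    moreover have "h v x \<notin> E0 `` {x}"
      using bound[of v v x "h v x" 1] v h[of v x] g by auto
    moreover have "(E0 \<union> M) `` {x} = insert (h v x) (E0 `` {x})" using Mx by auto
    moreover have "finite (E0 `` {x})" using finE[of x] by (rule finite_subset[rotated]) (auto simp: E0_def)
    ultimately show ?thesis using k by simp
  next
    case False
    then have "M `` {x} = {}" by (auto simp: M_def)
    moreover have "E0 `` {x} = E `` {x}"
      using False x EV symD[OF symE] by (auto simp: E0_def W_def S_def)
    ultimately have "(E0 \<union> M) `` {x} = E `` {x}" by auto
    then show ?thesis using deg x by (simp add: W_def)
  qed
  moreover have "E0 \<union> M \<subseteq> W \<times> W"
    using SW h by (fastforce simp: E0_def M_def)
  moreover have "sym (E0 \<union> M)"
    using symM symE by (auto simp: sym_def E0_def)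
  moreover have "irrefl (E0 \<union> M)"
    using irr h by (fastforce simp: irrefl_def E0_def M_def)
  ultimately have "kgraph k g W (E0 \<union> M)" using fin by (auto simp: kgraph_def W_def)
  moreover have "card W < card V"
    unfolding W_def using X fin by (intro psubset_card_mono) auto
  moreover have "W \<noteq> {}"
  proof
    assume "W = {}"
    then have "V = X" using X by (auto simp: W_def)
    obtain v where "v \<in> X" using X by blast
    then have "card (E `` {v}) = k" using deg X by auto
    moreover have "E `` {v} \<subseteq> X" using EV \<open>V = X\<close> by auto
    ultimately have "k \<le> card X" using fin \<open>V = X\<close> card_mono by metis
    with X k show False by simp
  qed
  ultimately show ?thesis by blast
qed

text \<open>Deletes a vertex if \<open>k\<close> is even and both ends of an edge if
  \<open>k\<close> is odd: each deleted vertex then has an even number, \<open>k\<close> or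
  \<open>k - 1\<close>, of remaining neighbours to be paired.\<close>

lemma smaller_girth_smaller_order:
  assumes G: "kgraph k (Suc g) V E" and k: "3 \<le> k" and g: "3 \<le> g" and ne: "V \<noteq> {}"
  shows "\<exists>V' E' :: 'v rel. kgraph k g V' E' \<and> V' \<noteq> {} \<and> card V' < card (V :: 'v set)"
proof -
  have EV: "E \<subseteq> V \<times> V" and irr: "irrefl E" and symE: "sym E"
    and deg: "\<And>v. v \<in> V \<Longrightarrow> card (E `` {v}) = k"
    using G unfolding kgraph_def by auto
  obtain v where v: "v \<in> V" using ne by blast
  show ?thesis
  proof (cases "even k")
    case True
    have "E `` {v} - {v} = E `` {v}" using irr by (auto simp: irrefl_def)
    then show ?thesis
      using delete_clique_and_match[OF G k g, of "{v}"] v deg True by simp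
  next
    case False
    have "E `` {v} \<noteq> {}" using deg[OF v] k by auto
    then obtain u where u: "(v, u) \<in> E" by blast
    then have *: "(u, v) \<in> E" "u \<in> V" "u \<noteq> v" using symE EV irr by (auto simp: sym_def irrefl_def)
    have eq: "E `` {v} - {v, u} = E `` {v} - {u}" "E `` {u} - {v, u} = E `` {u} - {v}"
      using irr by (auto simp: irrefl_def)
    have "card (E `` {v} - {u}) = k - 1" "card (E `` {u} - {v}) = k - 1"
      using u * deg v by simp_all
    then have cards: "card (E `` {v} - {v, u}) = k - 1" "card (E `` {u} - {v, u}) = k - 1"
      unfolding eq by simp_all
    have "even (k - 1)" using False by simp
    then have "even (card (E `` {w} - {v, u}))" if "w \<in> {v, u}" for w
      using that cards by (elim insertE emptyE) simp_all
    moreover have "p \<noteq> q \<Longrightarrow> (p, q) \<in> E" if "p \<in> {v, u}" "q \<in> {v, u}" for p q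
      using that u * by auto
    ultimately show ?thesis
      using v * by (intro delete_clique_and_match[OF G k g, of "{v, u}"]) auto
  qed
qed

section \<open>Self-packing\<close>

text \<open>
  Two copies of a graph are glued along \<open>x \<leadsto> \<phi> x\<close>, where \<open>R\<close> consists of the pairs of gluing vertices
  that are too close together: no such pair may be mapped to such a pair. In the application \<open>R\<close>
  is a partial injection that raises a class \<open>\<kappa>\<close> in the integers modulo \<open>g\<close> by one.
\<close>

definition cyclic_shift_rel :: "nat \<Rightarrow> ('v \<Rightarrow> int) \<Rightarrow> 'v set \<Rightarrow> 'v rel \<Rightarrow> bool" where
  "cyclic_shift_rel g \<kappa> D R \<longleftrightarrow> R \<subseteq> D \<times> D \<and> single_valued R \<and> single_valued (R\<inverse>) \<and>
     (\<forall>x y. (x, y) \<in> R \<longrightarrow> int g dvd \<kappa> y - \<kappa> x - 1)"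

definition packs :: "'v set \<Rightarrow> 'v rel \<Rightarrow> ('v \<Rightarrow> 'v) \<Rightarrow> bool" where
  "packs D R \<phi> \<longleftrightarrow> bij_betw \<phi> D D \<and> (\<forall>x y. (x, y) \<in> R \<longrightarrow> (\<phi> x, \<phi> y) \<notin> R \<and> (\<phi> y, \<phi> x) \<notin> R)"

text \<open>
  If \<open>R\<close> is the graph of a permutation \<open>f\<close>, then \<open>\<phi> x = f\<^bsup>\<kappa> x\<^esup> x\<close> doubles the class modulo \<open>g\<close>, so that pairs
  in \<open>R\<close> go to pairs whose classes differ by \<open>2\<close>, which is not \<open>\<plusminus>1\<close>.
\<close>

lemma packing_total:
  assumes fin: "finite D" and g: "odd g" "5 \<le> g" and R: "cyclic_shift_rel g \<kappa> D R"
    and total: "\<And>x. x \<in> D \<Longrightarrow> \<exists>y. (x, y) \<in> R"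
  shows "\<exists>\<phi>. packs D R \<phi>"
proof -
  have RD: "R \<subseteq> D \<times> D" and sv: "single_valued R" "single_valued (R\<inverse>)"
    and \<kappa>: "\<And>x y. (x, y) \<in> R \<Longrightarrow> int g dvd \<kappa> y - \<kappa> x - 1"
    using R unfolding cyclic_shift_rel_def by auto
  obtain f where f: "\<And>x. x \<in> D \<Longrightarrow> (x, f x) \<in> R" using total by metis
  have fD: "f x \<in> D" if "x \<in> D" for x using f[OF that] RD by auto
  have finj: "x = y" if "x \<in> D" "y \<in> D" "f x = f y" for x y
    using f[OF that(1)] f[OF that(2)] that(3) sv(2) by (auto simp: single_valued_def)
  have fnD: "(f ^^ n) x \<in> D" if "x \<in> D" for n x using that by (induction n) (auto simp: fD)
  have fninj: "x = y" if "x \<in> D" "y \<in> D" "(f ^^ n) x = (f ^^ n) y" for n x y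
    using that
  proof (induction n)
    case (Suc n)
    then show ?case using finj[OF fnD fnD] by auto
  qed simp
  have \<kappa>n: "int g dvd \<kappa> ((f ^^ n) x) - \<kappa> x - int n" if "x \<in> D" for n x
  proof (induction n)
    case (Suc n)
    have "int g dvd (\<kappa> ((f ^^ n) x) - \<kappa> x - int n) + (\<kappa> (f ((f ^^ n) x)) - \<kappa> ((f ^^ n) x) - 1)"
      using Suc.IH \<kappa>[OF f[OF fnD[OF that]]] by (rule dvd_add)
    then show ?case by (simp add: algebra_simps)
  qed simp
  define e where "e = (\<lambda>x. nat (\<kappa> x mod int g))"
  define \<phi> where "\<phi> = (\<lambda>x. (f ^^ e x) x)"
  have \<kappa>\<phi>: "int g dvd \<kappa> (\<phi> x) - 2 * \<kappa> x" if "x \<in> D" for x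
  proof -
    have "int (e x) = \<kappa> x mod int g" using g by (simp add: e_def)
    then have "int g dvd \<kappa> x - int (e x)" by (simp add: dvd_minus_mod)
    with \<kappa>n[OF that, of "e x"]
    have "int g dvd (\<kappa> ((f ^^ e x) x) - \<kappa> x - int (e x)) - (\<kappa> x - int (e x))" by (rule dvd_diff)
    then show ?thesis by (simp add: \<phi>_def)
  qed
  \<comment> \<open>Doubling is invertible modulo the odd number \<open>g\<close>, so equal images
    have equal classes, hence equal exponents, and iterates of \<open>f\<close> are
    injective.\<close>
  have "inj_on \<phi> D"
  proof (rule inj_onI)
    fix x y assume xy: "x \<in> D" "y \<in> D" "\<phi> x = \<phi> y"
    have "int g dvd (\<kappa> (\<phi> x) - 2 * \<kappa> y) - (\<kappa> (\<phi> x) - 2 * \<kappa> x)"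
      using \<kappa>\<phi>[OF xy(1)] \<kappa>\<phi>[OF xy(2)] xy(3) by (metis dvd_diff)
    then have "int g dvd 2 * (\<kappa> x - \<kappa> y)" by (simp add: algebra_simps)
    moreover have "coprime (int g) 2" using g by simp
    ultimately have "int g dvd \<kappa> x - \<kappa> y" by (metis coprime_dvd_mult_right_iff)
    then have "e x = e y" unfolding e_def by (metis mod_eq_dvd_iff)
    then show "x = y" using fninj[OF xy(1,2)] xy(3) by (simp add: \<phi>_def)
  qed
  moreover have "\<phi> ` D \<subseteq> D" using fnD by (auto simp: \<phi>_def)
  ultimately have "bij_betw \<phi> D D" using fin by (simp add: bij_betw_def endo_inj_surj)
  moreover have "(\<phi> x, \<phi> y) \<notin> R \<and> (\<phi> y, \<phi> x) \<notin> R" if xyR: "(x, y) \<in> R" for x y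
  proof -
    have xy: "x \<in> D" "y \<in> D" using xyR RD by auto
    obtain a b c where abc: "\<kappa> (\<phi> x) - 2 * \<kappa> x = int g * a" "\<kappa> (\<phi> y) - 2 * \<kappa> y = int g * b"
      "\<kappa> y - \<kappa> x - 1 = int g * c"
      using \<kappa>\<phi>[OF xy(1)] \<kappa>\<phi>[OF xy(2)] \<kappa>[OF xyR] unfolding dvd_def by blast
    have False if R1: "(\<phi> x, \<phi> y) \<in> R"
    proof -
      obtain d where "\<kappa> (\<phi> y) - \<kappa> (\<phi> x) - 1 = int g * d" using \<kappa>[OF R1] unfolding dvd_def by blast
      with abc have "1 = int g * (d - b - 2 * c + a)" by (simp add: algebra_simps)
      then have "int g dvd 1" by (rule dvdI)
      then show False using g by auto
    qed
    moreover have False if R1: "(\<phi> y, \<phi> x) \<in> R"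
    proof -
      obtain d where "\<kappa> (\<phi> x) - \<kappa> (\<phi> y) - 1 = int g * d" using \<kappa>[OF R1] unfolding dvd_def by blast
      with abc have "3 = int g * (a - b - 2 * c - d)" by (simp add: algebra_simps)
      then have "int g dvd 3" by (rule dvdI)
      then show False using g zdvd_imp_le by fastforce
    qed
    ultimately show ?thesis by blast
  qed
  ultimately show ?thesis unfolding packs_def by blast
qed

text \<open>Around a triangle the classes change by three terms \<open>1\<close> or
  \<open>-1\<close>, whose sum is one of \<open>1\<close>, \<open>-1\<close>, \<open>3\<close>,
  \<open>-3\<close> and hence no multiple of \<open>g\<close>. A loop would make \<open>g\<close>
  divide \<open>1\<close>.\<close>

lemma cyclic_shift_rel_no_triangle:
  assumes R: "cyclic_shift_rel g \<kappa> D R" and g: "odd g" "5 \<le> g"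
  shows "(a, b) \<in> R \<union> R\<inverse> \<Longrightarrow> (b, c) \<in> R \<union> R\<inverse> \<Longrightarrow> (c, a) \<notin> R \<union> R\<inverse>" and "(a, a) \<notin> R"
proof -
  have step: "\<exists>s t. \<kappa> y - \<kappa> x = s + int g * t \<and> (s = 1 \<or> s = - 1)" if "(x, y) \<in> R \<union> R\<inverse>" for x y
  proof (cases "(x, y) \<in> R")
    case True
    then obtain t where "\<kappa> y - \<kappa> x - 1 = int g * t" using R unfolding cyclic_shift_rel_def dvd_def by blast
    then show ?thesis by (intro exI[of _ 1] exI[of _ t]) simp
  next
    case False
    then have "(y, x) \<in> R" using that by blast
    then obtain t where "\<kappa> x - \<kappa> y - 1 = int g * t" using R unfolding cyclic_shift_rel_def dvd_def by blast
    then show ?thesis by (intro exI[of _ "- 1"] exI[of _ "- t"]) (simp add: algebra_simps)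
  qed
  have small: "\<not> int g dvd n" if "n \<in> {1, 3, -1, -3}" for n
    using that g zdvd_imp_le[of "int g" n] zdvd_imp_le[of "int g" "- n"] by auto
  show "(c, a) \<notin> R \<union> R\<inverse>" if "(a, b) \<in> R \<union> R\<inverse>" "(b, c) \<in> R \<union> R\<inverse>"
  proof
    assume "(c, a) \<in> R \<union> R\<inverse>"
    with step that obtain s1 t1 s2 t2 s3 t3 where *: "\<kappa> b - \<kappa> a = s1 + int g * t1" "\<kappa> c - \<kappa> b = s2 + int g * t2"
      "\<kappa> a - \<kappa> c = s3 + int g * t3" "s1 = 1 \<or> s1 = -1" "s2 = 1 \<or> s2 = -1" "s3 = 1 \<or> s3 = - 1"
      by metis
    then have "s1 + s2 + s3 = int g * (- t1 - t2 - t3)" by (simp add: algebra_simps)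
    then have "int g dvd s1 + s2 + s3" by (rule dvdI)
    then show False using small[of "s1 + s2 + s3"] * by auto
  qed
  show "(a, a) \<notin> R"
    using step[of a a] small[of 1] small[of "-1"]
    by (metis UnI1 diff_self dvd_add_times_triv_right_iff dvd_0_right insertI1 insertI2 mult.commute)
qed

text \<open>The exchange sends \<open>c\<close>, which lies in every pair of \<open>R\<close>, to
  the isolated vertex \<open>v\<close>.\<close>

lemma packs_swap_isolated:
  assumes iso: "v \<notin> Field R" and vc: "v \<in> D" "c \<in> D" "v \<noteq> c"
    and rest: "\<And>x y. (x, y) \<in> R \<Longrightarrow> x = c \<or> y = c" and irr: "(c, c) \<notin> R"
  shows "packs D R (id(v := c, c := v))"
proof -
  have "bij_betw (id(v := c, c := v)) D D"
    using vc by (auto simp: bij_betw_def inj_on_def image_def)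
  moreover have "((id(v := c, c := v)) x, (id(v := c, c := v)) y) \<notin> R \<and>
    ((id(v := c, c := v)) y, (id(v := c, c := v)) x) \<notin> R" if xy: "(x, y) \<in> R" for x y
  proof -
    have noiso: "(v, z) \<notin> R" "(z, v) \<notin> R" for z using iso by (auto simp: Field_def)
    then have "x \<noteq> v" "y \<noteq> v" using xy by blast+
    then show ?thesis using rest[OF xy] xy irr noiso by auto
  qed
  ultimately show ?thesis unfolding packs_def by blast
qed

text \<open>If \<open>v\<close> is isolated, the other three vertices do not form a triangle, so one
  of them lies in all pairs and can be exchanged with \<open>v\<close>. Otherwise \<open>v\<close>
  has a unique predecessor \<open>u\<close>, and a cyclic permutation of all four vertices
  works.\<close>

lemma packing_four:
  assumes D: "card D = 4" and g: "odd g" "5 \<le> g" and R: "cyclic_shift_rel g \<kappa> D R"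
    and v: "v \<in> D" "\<And>y. (v, y) \<notin> R"
  shows "\<exists>\<phi>. packs D R \<phi>"
proof -
  have RD: "R \<subseteq> D \<times> D" and sv: "\<And>x y z. (x, y) \<in> R \<Longrightarrow> (x, z) \<in> R \<Longrightarrow> y = z"
    "\<And>x y z. (x, z) \<in> R \<Longrightarrow> (y, z) \<in> R \<Longrightarrow> x = y"
    using R unfolding cyclic_shift_rel_def by (auto simp: single_valued_def)
  note tri = cyclic_shift_rel_no_triangle[OF R g]
  have "card (D - {v}) = 3" using D v by (simp add: card_Diff_singleton)
  then obtain p q t where pqt: "D - {v} = {p, q, t}" "p \<noteq> q" "q \<noteq> t" "p \<noteq> t" using card_3_iff by metis
  show ?thesis
  proof (cases "\<exists>u. (u, v) \<in> R")
    case False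
    have iso: "v \<notin> Field R" using v(2) False by (auto simp: Field_def)
    have "\<exists>c a b. D - {v} = {c, a, b} \<and> (a, b) \<notin> R \<union> R\<inverse>"
    proof (cases "(q, t) \<in> R \<union> R\<inverse>")
      case True
      show ?thesis
      proof (cases "(t, p) \<in> R \<union> R\<inverse>")
        case True
        then have "(p, q) \<notin> R \<union> R\<inverse>" using tri(1) \<open>(q, t) \<in> R \<union> R\<inverse>\<close> by blast
        moreover have "D - {v} = {t, p, q}" unfolding pqt(1) by blast
        ultimately show ?thesis by blast
      next
        case False
        moreover have "D - {v} = {q, t, p}" unfolding pqt(1) by blast
        ultimately show ?thesis by blast
      qed
    qed (use pqt in blast)
    then obtain c a b where c: "D - {v} = {c, a, b}" "(a, b) \<notin> R \<union> R\<inverse>" by blast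
    have "x = c \<or> y = c" if "(x, y) \<in> R" for x y
    proof -
      have "x \<in> {c, a, b}" "y \<in> {c, a, b}"
        using that RD iso unfolding c(1)[symmetric] by (auto simp: Field_def)
      then show ?thesis using that c(2) tri(2) by auto
    qed
    then show ?thesis
      using packs_swap_isolated[OF iso v(1), of c] c(1) tri(2) by blast
  next
    case True
    then obtain u where u: "(u, v) \<in> R" by blast
    then have uD: "u \<in> D - {v}" using RD v by auto
    have "\<exists>q t. D - {v} = {u, q, t} \<and> u \<noteq> q \<and> q \<noteq> t \<and> u \<noteq> t"
    proof -
      have "u \<in> {p, q, t}" using uD unfolding pqt(1) .
      moreover have "{p, q, t} = {q, p, t}" "{p, q, t} = {t, p, q}" by blast+
      ultimately show ?thesis using pqt by (elim insertE emptyE) metis+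
    qed
    then obtain q' t' where q't': "D - {v} = {u, q', t'}" "u \<noteq> q'" "q' \<noteq> t'" "u \<noteq> t'" by blast
    \<comment> \<open>As \<open>u\<close> has at most one predecessor, the other two vertices can be
      named so that \<open>t\<close> is not it.\<close>
    have "\<exists>q t. D - {v} = {u, q, t} \<and> u \<noteq> q \<and> q \<noteq> t \<and> u \<noteq> t \<and> (t, u) \<notin> R"
    proof (cases "(t', u) \<in> R")
      case True
      then have "(q', u) \<notin> R" using sv q't' by blast
      moreover have "D - {v} = {u, t', q'}" unfolding q't'(1) by blast
      ultimately show ?thesis using q't'(2-4) by blast
    qed (use q't' in blast)
    then obtain q t where qt: "D - {v} = {u, q, t}" "u \<noteq> q" "q \<noteq> t" "u \<noteq> t" "(t, u) \<notin> R" by blast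
    have D4: "D = {v, u, q, t}" using qt(1) v by auto
    have vn: "v \<noteq> u" "v \<noteq> q" "v \<noteq> t" using qt(1) by auto
    \<comment> \<open>The pair \<open>(u, v)\<close> goes to \<open>(t, u)\<close>, unrelated by the
      choice of \<open>t\<close>. Any other pair of \<open>R\<close> contains \<open>q\<close>,
      which goes to \<open>v\<close>, and the other end does not go to \<open>u\<close>, the only
      vertex related to \<open>v\<close>.\<close>
    let ?\<phi> = "id(v := u, u := t, q := v, t := q)"
    have "bij_betw ?\<phi> D D"
      using qt(2-4) vn unfolding D4 by (auto simp: bij_betw_def inj_on_def)
    moreover have "(?\<phi> x, ?\<phi> y) \<notin> R \<and> (?\<phi> y, ?\<phi> x) \<notin> R" if xy: "(x, y) \<in> R" for x y
    proof -
      have "(u, t) \<notin> R" using sv(1)[OF u] vn by blast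
      moreover have "(x, v) \<notin> R" if "x \<noteq> u" for x using sv(2)[OF u] that by blast
      moreover have "x \<in> {v, u, q, t}" "y \<in> {v, u, q, t}" using xy RD D4 by auto
      ultimately show ?thesis using xy v(2) tri(2) qt(2-5) vn by auto
    qed
    ultimately show ?thesis unfolding packs_def by blast
  qed
qed

text \<open>
  The vertex \<open>v\<close> has at most one neighbour \<open>u\<close> in \<open>R\<close>, so fixing \<open>v\<close> fails only if \<open>\<phi> u = u\<close>; then \<open>v\<close> is
  exchanged with some \<open>w\<close>, and \<open>R\<close> excludes at most two of the at least three candidates.
\<close>

lemma packing_extend:
  assumes fin: "finite D" and D: "5 \<le> card D" and R: "cyclic_shift_rel g \<kappa> D R" and g: "odd g" "5 \<le> g"
    and v: "v \<in> D" "\<And>y. (v, y) \<notin> R"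
    and \<phi>: "packs (D - {v}) (R \<inter> (D - {v}) \<times> (D - {v})) \<phi>"
  shows "\<exists>\<phi>. packs D R \<phi>"
proof -
  let ?D = "D - {v}"
  have RD: "R \<subseteq> D \<times> D" and sv: "\<And>x y z. (x, y) \<in> R \<Longrightarrow> (x, z) \<in> R \<Longrightarrow> y = z"
    "\<And>x y z. (x, z) \<in> R \<Longrightarrow> (y, z) \<in> R \<Longrightarrow> x = y"
    using R unfolding cyclic_shift_rel_def by (auto simp: single_valued_def)
  note irr = cyclic_shift_rel_no_triangle(2)[OF R g]
  have bij: "bij_betw \<phi> ?D ?D" using \<phi> unfolding packs_def by blast
  have ran: "\<phi> x \<in> ?D" if "x \<in> ?D" for x using bij that by (meson bij_betwE)
  have inj: "x = y" if "x \<in> ?D" "y \<in> ?D" "\<phi> x = \<phi> y" for x y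
    using bij that by (meson bij_betw_imp_inj_on inj_onD)
  have old: "(\<phi> x, \<phi> y) \<notin> R \<and> (\<phi> y, \<phi> x) \<notin> R" if "(x, y) \<in> R" "x \<noteq> v" "y \<noteq> v" for x y
  proof -
    have "x \<in> ?D" "y \<in> ?D" using that RD by auto
    then show ?thesis using \<phi> ran that unfolding packs_def by blast
  qed
  show ?thesis
  proof (cases "\<forall>u. (u, v) \<in> R \<longrightarrow> \<phi> u \<noteq> u")
    case True
    have "bij_betw (\<phi>(v := v)) D D"
    proof -
      have "bij_betw (\<phi>(v := v)) ?D ?D" using bij by (rule bij_betw_cong[THEN iffD1, rotated]) auto
      from bij_betw_combine[OF this, of "{v}" "{v}"] show ?thesis
        using v by (simp add: insert_absorb)
    qed
    moreover have "((\<phi>(v := v)) x, (\<phi>(v := v)) y) \<notin> R \<and> ((\<phi>(v := v)) y, (\<phi>(v := v)) x) \<notin> R"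
      if "(x, y) \<in> R" for x y
    proof -
      have "x \<noteq> v" using that v by auto
      show ?thesis
      proof (cases "y = v")
        case y: True
        then have "(\<phi> x, v) \<notin> R" using sv(2)[of x v "\<phi> x"] that True by auto
        then show ?thesis using y v \<open>x \<noteq> v\<close> by auto
      qed (use old that \<open>x \<noteq> v\<close> in auto)
    qed
    ultimately show ?thesis unfolding packs_def by blast
  next
    case False
    then obtain u where u: "(u, v) \<in> R" "\<phi> u = u" by blast
    have uD: "u \<in> ?D" using u v RD by auto
    have "\<exists>w \<in> ?D - {u}. (w, u) \<notin> R \<and> (\<phi> w, u) \<notin> R"
    proof (rule ccontr)
      assume "\<not> ?thesis"
      then have sub: "?D - {u} \<subseteq> {w \<in> ?D. (w, u) \<in> R} \<union> {w \<in> ?D. (\<phi> w, u) \<in> R}" by blast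
      have fin2: "finite {w \<in> ?D. (w, u) \<in> R}" "finite {w \<in> ?D. (\<phi> w, u) \<in> R}" using fin by auto
      have "card {w \<in> ?D. (w, u) \<in> R} \<le> Suc 0"
        using card_le_Suc0_iff_eq[OF fin2(1)] sv(2) by blast
      moreover have "card {w \<in> ?D. (\<phi> w, u) \<in> R} \<le> Suc 0"
        using card_le_Suc0_iff_eq[OF fin2(2)] sv(2) inj by blast
      moreover have "card (?D - {u}) \<le> card {w \<in> ?D. (w, u) \<in> R} + card {w \<in> ?D. (\<phi> w, u) \<in> R}"
        using card_mono[OF _ sub] fin2 card_Un_le[of "{w \<in> ?D. (w, u) \<in> R}" "{w \<in> ?D. (\<phi> w, u) \<in> R}"] by simp
      moreover have "card (?D - {u}) = card D - 2" using fin v uD by (simp add: card_Diff_singleton)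
      ultimately show False using D by simp
    qed
    then obtain w where w: "w \<in> ?D" "w \<noteq> u" "(w, u) \<notin> R" "(\<phi> w, u) \<notin> R" by blast
    let ?\<phi> = "\<phi>(v := \<phi> w, w := v)"
    have "inj_on ?\<phi> D"
    proof (rule inj_onI)
      fix x y assume "x \<in> D" "y \<in> D" "?\<phi> x = ?\<phi> y"
      then show "x = y"
        using inj[of x y] inj[of x w] inj[of y w] ran[of x] ran[of y] ran[of w] w(1)
        by (auto split: if_splits)
    qed
    moreover have "?\<phi> ` D \<subseteq> D" using ran w(1) v by auto
    ultimately have "bij_betw ?\<phi> D D" unfolding bij_betw_def using endo_inj_surj[OF fin] by blast
    moreover have "(?\<phi> x, ?\<phi> y) \<notin> R \<and> (?\<phi> y, ?\<phi> x) \<notin> R" if xy: "(x, y) \<in> R" for x y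
    proof -
      have xv: "x \<noteq> v" using xy v by auto
      have xyD: "x \<in> D" "y \<in> D" using xy RD by auto
      have pre_u: "z = u" if "(\<phi> z, v) \<in> R" "z \<in> ?D" for z
        using sv(2)[OF that(1) u(1)] inj[OF that(2) uD] u(2) by simp
      \<comment> \<open>In the first case \<open>x = u\<close>, and the choice of \<open>w\<close>
        keeps \<open>\<phi> w\<close> and \<open>u\<close> unrelated. If \<open>w\<close> is in the
        pair, its image contains \<open>v\<close>, so only the partner \<open>u\<close> could do
        harm; but \<open>(w, u)\<close> is excluded by the choice of \<open>w\<close>, and
        \<open>(u, w)\<close> because \<open>v\<close> is the only successor of
        \<open>u\<close>.\<close>
      consider "y = v" | "y \<noteq> v" "x = w" | "y \<noteq> v" "y = w" "x \<noteq> w" | "y \<noteq> v" "x \<noteq> w" "y \<noteq> w" by blast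
      then show ?thesis
      proof cases
        case 1
        then have "x = u" using sv(2)[OF _ u(1)] xy by blast
        moreover have "(u, \<phi> w) \<notin> R" using sv(1)[OF u(1)] ran[OF w(1)] by auto
        ultimately show ?thesis using 1 w u(2) uD by auto
      next
        case 2
        then have "y \<noteq> w" using xy irr by auto
        moreover have "(\<phi> y, v) \<notin> R" using pre_u[of y] 2 xyD xy w by auto
        ultimately show ?thesis using 2 v w by auto
      next
        case 3
        have "(\<phi> x, v) \<notin> R" using pre_u[of x] xyD xy xv 3 sv(1)[OF u(1)] by auto
        then show ?thesis using 3 v w xv by auto
      qed (use old[OF xy] xv in auto)
    qed
    ultimately show ?thesis unfolding packs_def by blast
  qed
qed

text \<open>Vertices without a successor are peeled off until the relation is total or only four
  vertices remain; they are put back by \<open>packing_extend\<close>.\<close>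

lemma packing:
  assumes "finite D" "4 \<le> card D" "odd g" "5 \<le> g" "cyclic_shift_rel g \<kappa> D R"
  shows "\<exists>\<phi>. packs D R \<phi>"
  using assms
proof (induction "card D" arbitrary: D R rule: less_induct)
  case less
  show ?case
  proof (cases "\<forall>x\<in>D. \<exists>y. (x, y) \<in> R")
    case True
    then show ?thesis using packing_total less.prems by blast
  next
    case False
    then obtain v where v: "v \<in> D" "\<And>y. (v, y) \<notin> R" by blast
    show ?thesis
    proof (cases "card D = 4")
      case True
      then show ?thesis using packing_four[OF True less.prems(3-5) v] by blast
    next
      case False
      let ?D = "D - {v}" let ?R = "R \<inter> ?D \<times> ?D"
      have "card ?D < card D" "4 \<le> card ?D" using False less.prems v
        by (auto simp: card_Diff_singleton card_gt_0_iff)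
      moreover have "cyclic_shift_rel g \<kappa> ?D ?R"
        using less.prems(5) unfolding cyclic_shift_rel_def single_valued_def by auto
      ultimately obtain \<phi> where "packs ?D ?R \<phi>"
        using less.hyps[of ?D ?R] less.prems by auto
      moreover have "5 \<le> card D" using False less.prems by simp
      ultimately show ?thesis using packing_extend[of D g \<kappa> R v] less.prems v by blast
    qed
  qed
qed

section \<open>Doubling\<close>

text \<open>Every vertex of \<open>D\<close> exchanges its single edge out of \<open>A\<close> for a
  matching edge to the other copy, which keeps the degrees. Cycles with two matching edges are
  bounded by \<open>sep\<close>, those with more by \<open>far\<close>.\<close>

lemma double_copy:
  fixes V :: "'v set"
  assumes G: "kgraph k g V E" and k: "1 \<le> k" and A: "A \<subseteq> V" and DA: "D \<subseteq> A"
    and degD: "\<And>x. x \<in> D \<Longrightarrow> card (E `` {x} - A) = 1"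
    and degA: "\<And>x. x \<in> A - D \<Longrightarrow> E `` {x} \<subseteq> A"
    and \<phi>: "bij_betw \<phi> D D"
    and far: "\<And>x y d. x \<in> D \<Longrightarrow> y \<in> D \<Longrightarrow> x \<noteq> y \<Longrightarrow> (x, y) \<in> (E \<inter> A \<times> A) ^^ d \<Longrightarrow> s \<le> d"
    and s: "g \<le> 3 * s + 3"
    and sep: "\<And>x y d d'. x \<in> D \<Longrightarrow> y \<in> D \<Longrightarrow> x \<noteq> y \<Longrightarrow> (x, y) \<in> (E \<inter> A \<times> A) ^^ d \<Longrightarrow>
      (\<phi> x, \<phi> y) \<in> (E \<inter> A \<times> A) ^^ d' \<Longrightarrow> g \<le> d + d' + 2"
  shows "\<exists>E'. kgraph k g (A \<times> (UNIV :: bool set)) E'"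
proof -
  have fin: "finite V" and EV: "E \<subseteq> V \<times> V" and symE: "sym E" and irr: "irrefl E"
    and deg: "\<And>v. v \<in> V \<Longrightarrow> card (E `` {v}) = k" and girth: "girth_ge E g"
    using G unfolding kgraph_def by auto
  define EA where "EA = E \<inter> A \<times> A"
  have symEA: "sym EA" using symE by (auto simp: sym_def EA_def)
  define E0 where "E0 = {((x, b), (y, b)) | x y (b::bool). (x, y) \<in> EA}"
  define M where "M = {((x, False), (\<phi> x, True)) | x. x \<in> D} \<union> {((\<phi> x, True), (x, False)) | x. x \<in> D}"
  have \<phi>D: "\<phi> x \<in> D" if "x \<in> D" for x using \<phi> that by (meson bij_betwE)
  have \<phi>inj: "x = y" if "x \<in> D" "y \<in> D" "\<phi> x = \<phi> y" for x y
    using \<phi> that by (meson bij_betw_imp_inj_on inj_onD)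
  have E0w: "b = b' \<and> (x, y) \<in> EA ^^ d" if "((x, b), (y, b')) \<in> E0 ^^ d" for x b y b' d
    using that
  proof (induction d arbitrary: y b')
    case (Suc d)
    then obtain z c where "((x, b), (z, c)) \<in> E0 ^^ d" "((z, c), (y, b')) \<in> E0" by auto
    with Suc.IH[of z c] show ?case by (auto simp: E0_def)
  qed auto
  have symM: "sym M" unfolding sym_def M_def by auto
  have svM: "single_valued M" unfolding single_valued_def M_def using \<phi>inj by auto
  have domM: "fst p \<in> D" if "p \<in> Domain M" for p using that \<phi>D by (auto simp: M_def)
  have farM: "s \<le> d" if "p \<in> Domain M" "q \<in> Domain M" "p \<noteq> q" "(p, q) \<in> E0 ^^ d" for p q d
  proof -
    have "snd p = snd q" "(fst p, fst q) \<in> EA ^^ d" using E0w[of "fst p" "snd p" "fst q" "snd q" d] that(4) by auto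
    then show ?thesis using far[of "fst p" "fst q" d] domM that by (auto simp: EA_def prod_eq_iff)
  qed
  have "girth_ge (E0 \<union> M) g"
  proof (rule girth_ge_matching[OF _ symM svM _ _ farM s])
    show "girth_ge E0 g"
      unfolding girth_ge_def
    proof (intro allI impI)
      fix c m assume c: "cyc E0 c m"
      have st: "(fst (c i), fst (c (Suc i))) \<in> E \<and> snd (c (Suc i)) = snd (c i)" for i
      proof -
        have "(c i, c (Suc i)) \<in> E0" using c unfolding cyc_def by blast
        then show ?thesis by (auto simp: E0_def EA_def)
      qed
      have "snd (c i) = snd (c 0)" for i by (induction i) (auto simp: st)
      then have "fst (c i) = fst (c j) \<longleftrightarrow> c i = c j" for i j by (auto simp: prod_eq_iff)
      then have "cyc E (\<lambda>i. fst (c i)) m" using c st unfolding cyc_def by simp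
      then show "g \<le> m" using girth unfolding girth_ge_def by blast
    qed
  next
    \<comment> \<open>The ends of a matching edge lie in different copies, so no walk of
      \<open>E0\<close> joins them.\<close>
    fix p q d assume "(p, q) \<in> M" "(q, p) \<in> E0 ^^ d"
    then show "g \<le> d + 1"
      using E0w[of "fst q" "snd q" "fst p" "snd p" d] by (auto simp: M_def)
  next
    fix p q p' q' d d'
    assume *: "(p, q) \<in> M" "(p', q') \<in> M" "q \<noteq> p'" "q' \<noteq> p" "(q, p') \<in> E0 ^^ d" "(q', p) \<in> E0 ^^ d'"
    have same: "snd q = snd p'" "(fst q, fst p') \<in> EA ^^ d" "snd q' = snd p" "(fst q', fst p) \<in> EA ^^ d'"
      using E0w[of "fst q" "snd q" "fst p'" "snd p'" d] E0w[of "fst q'" "snd q'" "fst p" "snd p" d'] * by auto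
    show "g \<le> d + d' + 2"
    proof (cases "snd p")
      case False
      then obtain x where x: "x \<in> D" "p = (x, False)" "q = (\<phi> x, True)" using *(1) by (auto simp: M_def)
      then obtain y where y: "y \<in> D" "p' = (\<phi> y, True)" "q' = (y, False)" using *(2) same by (auto simp: M_def)
      have w: "(x, y) \<in> EA ^^ d'" "(\<phi> x, \<phi> y) \<in> EA ^^ d"
        using same x y relpow_sym[OF symEA] by auto
      have "x \<noteq> y" using *(4) x y by auto
      from sep[OF x(1) y(1) this] w show ?thesis unfolding EA_def by fastforce
    next
      case True
      then obtain x where x: "x \<in> D" "q = (x, False)" "p = (\<phi> x, True)" using *(1) by (auto simp: M_def)
      then obtain y where y: "y \<in> D" "q' = (\<phi> y, True)" "p' = (y, False)" using *(2) same by (auto simp: M_def)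
      have w: "(x, y) \<in> EA ^^ d" "(\<phi> x, \<phi> y) \<in> EA ^^ d'"
        using same x y relpow_sym[OF symEA] by auto
      have "x \<noteq> y" using *(3) x y by auto
      from sep[OF x(1) y(1) this] w show ?thesis unfolding EA_def by fastforce
    qed
  qed
  moreover have "card ((E0 \<union> M) `` {z}) = k" if z: "z \<in> A \<times> UNIV" for z
  proof -
    obtain x b where xb: "z = (x, b)" "x \<in> A" using z by auto
    have E0z: "E0 `` {z} = (\<lambda>y. (y, b)) ` (EA `` {x})" unfolding E0_def xb by auto
    have finx: "finite (E `` {x})" using fin EV by (auto intro: finite_subset)
    have cEA: "card (E0 `` {z}) = card (EA `` {x})" unfolding E0z by (rule card_image) (simp add: inj_on_def)
    have EAx: "EA `` {x} = E `` {x} \<inter> A" using xb by (auto simp: EA_def)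
    show ?thesis
    proof (cases "x \<in> D")
      case True
      have "card (E `` {x} \<inter> A) + 1 = k"
        using degD[OF True] deg[of x] card_Int_Diff[OF finx, of A] A xb by auto
      moreover have "\<exists>y. M `` {z} = {(y, \<not> b)}"
      proof (cases b)
        case False
        then show ?thesis using True by (auto simp: M_def xb)
      next
        case b: True
        obtain w where w: "w \<in> D" "x = \<phi> w" using True \<phi> by (metis bij_betw_imp_surj_on imageE)
        then have "M `` {z} = {(w, \<not> b)}" using b \<phi>inj by (auto simp: M_def xb)
        then show ?thesis by blast
      qed
      then obtain y where y: "M `` {z} = {(y, \<not> b)}" by blast
      then have "(E0 \<union> M) `` {z} = insert (y, \<not> b) (E0 `` {z})" by blast
      moreover have "(y, \<not> b) \<notin> E0 `` {z}" unfolding E0z by auto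
      moreover have "finite (E0 `` {z})" unfolding E0z EAx using finx by blast
      ultimately show ?thesis using cEA EAx by simp
    next
      case False
      then have "M `` {z} = {}" using \<phi>D by (auto simp: M_def xb)
      moreover have "E `` {x} \<inter> A = E `` {x}" using degA[of x] False xb by blast
      ultimately have "(E0 \<union> M) `` {z} = E0 `` {z}" "card (E0 `` {z}) = card (E `` {x})"
        using cEA EAx by (auto simp: Un_Image)
      then show ?thesis using deg[of x] xb A by auto
    qed
  qed
  moreover have "E0 \<union> M \<subseteq> (A \<times> UNIV) \<times> (A \<times> UNIV)"
    using \<phi>D DA by (auto simp: E0_def M_def EA_def)
  moreover have "sym (E0 \<union> M)"
    using symM symEA by (auto simp: sym_def E0_def)
  moreover have "irrefl (E0 \<union> M)"
    using irr by (auto simp: irrefl_def E0_def M_def EA_def)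
  moreover have "finite (A \<times> (UNIV :: bool set))" using finite_subset[OF A fin] by simp
  ultimately have "kgraph k g (A \<times> UNIV) (E0 \<union> M)" unfolding kgraph_def by blast
  then show ?thesis by blast
qed

section \<open>Separating closed walks\<close>

text \<open>
  The closed walk \<open>c\<close> is not assumed to be injective: this lets the descent below replace it freely.
\<close>

locale separating_walk =
  fixes k g r :: nat and V :: "'v set" and E :: "'v rel" and A :: "'v set" and c :: "nat \<Rightarrow> 'v"
  assumes graph: "kgraph k g V E" and k: "3 \<le> k" and g: "g = 2 * r + 1" and r: "2 \<le> r"
    and minimal: "\<And>(W :: ('v \<times> bool) set) E'. kgraph k g W E' \<Longrightarrow> W \<noteq> {} \<Longrightarrow> card V \<le> card W"
    and A: "A \<subseteq> V" "A \<noteq> {}" and small: "2 * card A < card V"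
    and walk: "\<And>i. (c i, c (Suc i)) \<in> E" and period: "\<And>i. c (i + g) = c i"
    and disj: "A \<inter> range c = {}" and boundary: "\<And>x. x \<in> A \<Longrightarrow> E `` {x} \<subseteq> A \<union> range c"
begin

lemma fin: "finite V" and EV: "E \<subseteq> V \<times> V" and symE: "sym E" and irr: "(v, v) \<notin> E"
  and deg: "v \<in> V \<Longrightarrow> card (E `` {v}) = k" and girth: "girth_ge E g"
  using graph unfolding kgraph_def irrefl_def by auto

abbreviation "EA \<equiv> E \<inter> A \<times> A"
abbreviation "EC \<equiv> E \<inter> range c \<times> range c"

lemma sym_EA: "sym EA" and sym_EC: "sym EC"
  using symE by (auto simp: sym_def)

lemma c_mod: "c (i mod g) = c i"
proof -
  have "c (j + n * g) = c j" for j n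
    by (induction n) (simp_all add: period add.assoc[symmetric] add.commute[of g])
  from this[of "i mod g" "i div g"] show ?thesis by simp
qed

lemma c_walk: "(c i, c (i + t)) \<in> EC ^^ t"
  by (rule walk_segment) (auto simp: walk)

text \<open>One of the two arcs of a closed walk of length \<open>2 * r + 1\<close> has length at
  most \<open>r\<close>. The clause on indices records its direction, from which
  \<open>close_imp_R\<close> reads off that exits are antipodal.\<close>

lemma short_arc:
  obtains t where "t \<le> r" "(c i, c j) \<in> EC ^^ t" "(i + t) mod g = j mod g \<or> (j + t) mod g = i mod g"
proof -
  have main: "\<exists>t\<le>r. (c i, c j) \<in> EC ^^ t \<and> ((i + t) mod g = j mod g \<or> (j + t) mod g = i mod g)"
    if "i \<le> j" "j < g" for i j
  proof (cases "j - i \<le> r")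
    case True
    have "(c i, c j) \<in> EC ^^ (j - i)" using c_walk[of i "j - i"] that by simp
    then show ?thesis using True that by (intro exI[of _ "j - i"]) simp
  next
    case False
    have eq: "j + (g - (j - i)) = i + g" using that by simp
    have "(c j, c i) \<in> EC ^^ (g - (j - i))" using c_walk[of j "g - (j - i)"] unfolding eq period .
    then have "(c i, c j) \<in> EC ^^ (g - (j - i))" by (rule relpow_sym[OF sym_EC])
    moreover have "g - (j - i) \<le> r" using False g by simp
    ultimately show ?thesis using eq by (intro exI[of _ "g - (j - i)"]) simp
  qed
  have g0: "i mod g < g" "j mod g < g" using g by simp_all
  have "\<exists>t\<le>r. (c i, c j) \<in> EC ^^ t \<and> ((i + t) mod g = j mod g \<or> (j + t) mod g = i mod g)"
  proof (cases "i mod g \<le> j mod g")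
    case True
    then show ?thesis using main[OF True g0(2)] by (simp add: c_mod mod_add_left_eq)
  next
    case False
    then obtain t where "t \<le> r" "(c j, c i) \<in> EC ^^ t"
      "(j + t) mod g = i mod g \<or> (i + t) mod g = j mod g"
      using main[of "j mod g" "i mod g"] g0 by (auto simp: c_mod mod_add_left_eq)
    then show ?thesis using relpow_sym[OF sym_EC] by blast
  qed
  then show ?thesis using that by blast
qed

definition D :: "'v set" where "D = {x \<in> A. \<exists>i. (x, c i) \<in> E}"

text \<open>As \<open>c\<close> need not be injective, several indices may give the same exit
  vertex; one below \<open>g\<close> is fixed.\<close>

definition idx :: "'v \<Rightarrow> nat" where "idx x = (SOME i. i < g \<and> (x, c i) \<in> E)"

lemma D_subset: "D \<subseteq> A" by (auto simp: D_def)

lemma idx: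
  assumes "x \<in> D" shows "idx x < g" "(x, c (idx x)) \<in> E"
proof -
  obtain i where "(x, c i) \<in> E" using assms by (auto simp: D_def)
  then have "i mod g < g \<and> (x, c (i mod g)) \<in> E" unfolding c_mod using g by simp
  then show "idx x < g" "(x, c (idx x)) \<in> E" unfolding idx_def by (metis (mono_tags, lifting) someI)+
qed

text \<open>
  For gluing vertices \<open>x\<close>, \<open>y\<close> of \<open>D\<close>, a walk inside \<open>A\<close> closes up through \<open>c\<close>, which offers a
  return of length at most \<open>r\<close>.
\<close>

lemma detour:
  assumes "x \<in> D" "y \<in> D" "x \<noteq> y" "(x, y) \<in> EA ^^ d" "(c (idx x), c (idx y)) \<in> EC ^^ t"
  shows "g \<le> d + t + 2"
  by (rule two_walks_bound[OF girth symE disj assms(4,5)]) (use assms idx D_subset in auto)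

text \<open>Two exits joined by an arc of length at most \<open>r\<close> would force
  \<open>g \<le> r + 2\<close>, contrary to \<open>2 \<le> r\<close>.\<close>

lemma unique_exit:
  assumes "x \<in> A" "(x, c i) \<in> E" "(x, c j) \<in> E" shows "c i = c j"
proof (rule ccontr)
  assume ne: "c i \<noteq> c j"
  obtain t where t: "t \<le> r" "(c i, c j) \<in> EC ^^ t" using short_arc by metis
  have "g \<le> 0 + t + 2"
    by (rule two_walks_bound[OF girth symE disj _ t(2), of x x]) (use assms ne in auto)
  then show False using t g r by simp
qed

text \<open>The return along \<open>c\<close> costs at most \<open>r + 2\<close>, so the girth
  leaves at least \<open>r - 1\<close> for the walk inside \<open>A\<close>.\<close>

lemma far:
  assumes "x \<in> D" "y \<in> D" "x \<noteq> y" "(x, y) \<in> EA ^^ d" shows "r - 1 \<le> d"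
proof -
  obtain t where "t \<le> r" "(c (idx x), c (idx y)) \<in> EC ^^ t" using short_arc by metis
  with detour[OF assms] g show ?thesis by fastforce
qed

text \<open>The extremal pairs of \<open>far\<close>. As \<open>g\<close> is odd, every index has
  two antipodes, at \<open>r\<close> and \<open>-r\<close>; fixing the sign orients the pairs and
  makes \<open>R\<close> a partial injection.\<close>

definition R :: "'v rel" where
  "R = {(x, y). x \<in> D \<and> y \<in> D \<and> x \<noteq> y \<and> (x, y) \<in> EA ^^ (r - 1) \<and> (idx x + r) mod g = idx y}"

text \<open>With \<open>d \<le> r - 1\<close> and \<open>t \<le> r\<close>, the inequality of
  \<open>detour\<close> can only hold with equality, so the exits are antipodal.\<close>

lemma close_imp_R:
  assumes "x \<in> D" "y \<in> D" "x \<noteq> y" "(x, y) \<in> EA ^^ d" "d \<le> r - 1"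
  shows "(x, y) \<in> R \<or> (y, x) \<in> R"
proof -
  obtain t where t: "t \<le> r" "(c (idx x), c (idx y)) \<in> EC ^^ t"
    "(idx x + t) mod g = idx y mod g \<or> (idx y + t) mod g = idx x mod g" by (rule short_arc)
  have "d = r - 1" using far[OF assms(1-4)] assms(5) by simp
  moreover have "t = r" using detour[OF assms(1-4) t(2)] t(1) assms(5) g by simp
  ultimately show ?thesis
    using t(3) assms idx(1) relpow_sym[OF sym_EA] unfolding R_def by auto
qed

text \<open>Otherwise the walk through \<open>z\<close> would close up at the common exit with
  length \<open>2 * r\<close>, less than \<open>g\<close>. This gives injectivity of
  \<open>R\<close> in both directions.\<close>

lemma same_exit_not_close:
  assumes "x \<in> D" "y \<in> D" "idx x = idx y" "(x, z) \<in> EA ^^ (r - 1)" "(z, y) \<in> EA ^^ (r - 1)"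
  shows "x = y"
proof (rule ccontr)
  assume "x \<noteq> y"
  from detour[OF assms(1,2) this walk_append[OF assms(4,5)], of 0] assms(3) g r show False by simp
qed

lemma R_single_valued: "single_valued R" and R_converse_single_valued: "single_valued (R\<inverse>)"
proof -
  show "single_valued R"
  proof (rule single_valuedI)
    fix x y z assume "(x, y) \<in> R" "(x, z) \<in> R"
    then show "y = z"
      using same_exit_not_close[of y z x] relpow_sym[OF sym_EA, of x y] unfolding R_def by auto
  qed
  show "single_valued (R\<inverse>)"
  proof (rule single_valuedI)
    fix z x y assume "(z, x) \<in> R\<inverse>" "(z, y) \<in> R\<inverse>"
    then have xy: "x \<in> D" "y \<in> D" "(idx x + r) mod g = (idx y + r) mod g"
      "(x, z) \<in> EA ^^ (r - 1)" "(z, y) \<in> EA ^^ (r - 1)"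
      using relpow_sym[OF sym_EA] unfolding R_def by auto
    have "(int (idx x) + int r) mod int g = (int (idx y) + int r) mod int g"
      using xy(3) by (metis of_nat_add zmod_int)
    then have "int (idx x) mod int g = int (idx y) mod int g" by (simp add: mod_eq_dvd_iff)
    then have "idx x = idx y" using idx(1) xy(1,2) by simp
    then show "x = y" using same_exit_not_close xy by blast
  qed
qed

text \<open>Multiplication by \<open>2r - 1\<close> inverts multiplication by \<open>r\<close> modulo \<open>g = 2r + 1\<close>.\<close>

lemma R_cyclic_shift: "cyclic_shift_rel g (\<lambda>x. (2 * int r - 1) * int (idx x)) D R"
proof -
  have "int g dvd (2 * int r - 1) * int (idx y) - (2 * int r - 1) * int (idx x) - 1"
    if "(x, y) \<in> R" for x y
  proof -
    have "idx y = (idx x + r) mod g" using that unfolding R_def by auto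
    then have "int (idx x + r) = int g * int ((idx x + r) div g) + int (idx y)"
      by (metis mult_div_mod_eq of_nat_add of_nat_mult)
    then obtain q where q: "int (idx y) = int (idx x) + int r - int g * q"
      by (metis add_diff_cancel_left' of_nat_add)
    have g': "int g = 2 * int r + 1" using g by simp
    have "(2 * int r - 1) * int (idx y) - (2 * int r - 1) * int (idx x) - 1 =
      int g * (int r - 1 - (2 * int r - 1) * q)"
      unfolding q g' by (simp add: algebra_simps)
    then show ?thesis by (rule dvdI)
  qed
  then show ?thesis
    using R_single_valued R_converse_single_valued unfolding cyclic_shift_rel_def R_def by auto
qed

text \<open>Doubling \<open>A\<close> along \<open>\<phi>\<close> would contradict
  \<open>minimal\<close>. Both distances in \<open>sep\<close> are at least \<open>r - 1\<close>,
  and a packing prevents both from being equal to it, so their sum is at least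
  \<open>2 * r - 1\<close>.\<close>

lemma no_packing: "\<not> packs D R \<phi>"
proof
  assume \<phi>: "packs D R \<phi>"
  have \<phi>D: "\<phi> x \<in> D" if "x \<in> D" for x using \<phi> that unfolding packs_def by (meson bij_betwE)
  have \<phi>ne: "\<phi> x \<noteq> \<phi> y" if "x \<in> D" "y \<in> D" "x \<noteq> y" for x y
    using \<phi> that unfolding packs_def by (meson bij_betw_imp_inj_on inj_onD)
  have "\<exists>E'. kgraph k g (A \<times> (UNIV :: bool set)) E'"
  proof (rule double_copy[OF graph _ A(1) D_subset, where s = "r - 1" and \<phi> = \<phi>])
    show "1 \<le> k" "g \<le> 3 * (r - 1) + 3" using k g r by simp_all
    show "bij_betw \<phi> D D" using \<phi> unfolding packs_def by blast
  next
    fix x assume x: "x \<in> D"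
    then have "E `` {x} - A = {c (idx x)}"
      using idx(2)[OF x] boundary[of x] unique_exit[of x] D_subset disj by blast
    then show "card (E `` {x} - A) = 1" by simp
  next
    fix x assume "x \<in> A - D"
    then show "E `` {x} \<subseteq> A" using boundary[of x] unfolding D_def by blast
  next
    fix x y d d' assume xy: "x \<in> D" "y \<in> D" "x \<noteq> y" and w: "(x, y) \<in> EA ^^ d" "(\<phi> x, \<phi> y) \<in> EA ^^ d'"
    have "r - 1 \<le> d" "r - 1 \<le> d'" using far[OF xy w(1)] far[OF \<phi>D \<phi>D \<phi>ne w(2)] xy by auto
    moreover have "\<not> (d \<le> r - 1 \<and> d' \<le> r - 1)"
      using close_imp_R[OF xy w(1)] close_imp_R[OF \<phi>D \<phi>D \<phi>ne w(2)] xy \<phi> unfolding packs_def by blast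
    ultimately show "g \<le> d + d' + 2" using g r by arith
  qed (rule far)
  then obtain E' where "kgraph k g (A \<times> (UNIV :: bool set)) E'" by blast
  from minimal[OF this] A(2) small show False by (simp add: card_cartesian_product)
qed

lemma finite_D: "finite D"
  using D_subset A(1) fin by (meson finite_subset)

lemma card_D: "card D \<le> 3"
proof (rule ccontr)
  assume "\<not> card D \<le> 3"
  then have "\<exists>\<phi>. packs D R \<phi>"
    using g r by (intro packing[OF finite_D _ _ _ R_cyclic_shift]) auto
  then show False using no_packing by blast
qed

text \<open>
  If \<open>D\<close> is tiny and cannot be packed, a closed walk of length \<open>g\<close> formed by \<open>R\<close>-paths in \<open>A\<close> and an arc
  of \<open>c\<close> passes through all of \<open>D\<close>. It therefore cuts off what it leaves of \<open>A\<close>, which is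
  nonempty because \<open>y\<close> has a further neighbour in \<open>A\<close>, and that one cannot lie on the walk.
\<close>

lemma shrink:
  assumes D: "D \<subseteq> {x, y, z}" "y \<in> D" "x \<in> D" "z \<in> D" "y \<noteq> x" "y \<noteq> z"
    and yx: "(y, x) \<in> EA ^^ l" "l \<le> r - 1" and xz: "(x, z) \<in> EA ^^ m" "m \<le> r - 1"
    and zy: "(c (idx z), c (idx y)) \<in> EC ^^ t" and total: "l + m + t + 2 = g"
  shows "\<exists>A' c'. separating_walk k g r V E A' c' \<and> card A' < card A"
proof -
  obtain f1 where f1: "f1 0 = y" "f1 l = x" "\<And>i. i < l \<Longrightarrow> (f1 i, f1 (Suc i)) \<in> EA"
    using yx(1) unfolding relpow_fun_conv by blast
  obtain f2 where f2: "f2 0 = x" "f2 m = z" "\<And>i. i < m \<Longrightarrow> (f2 i, f2 (Suc i)) \<in> EA"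
    using xz(1) unfolding relpow_fun_conv by blast
  obtain b where b: "b 0 = c (idx z)" "b t = c (idx y)" "\<And>i. i < t \<Longrightarrow> (b i, b (Suc i)) \<in> EC"
    using zy unfolding relpow_fun_conv by blast
  define L where "L = l + m"
  define f where "f = (\<lambda>i. if i \<le> l then f1 i else f2 (i - l))"
  have f0: "f 0 = y" and fl: "f l = x" and fL: "f L = z"
    using f1 f2 by (auto simp: f_def L_def)
  have fstep: "(f i, f (Suc i)) \<in> EA" if "i < L" for i
  proof -
    consider "i < l" | "i = l" | "i > l" by linarith
    then show ?thesis
    proof cases
      case 2
      then show ?thesis using f1(2) f2(1) f2(3)[of 0] that by (simp add: f_def L_def)
    next
      case 3
      then show ?thesis using f2(3)[of "i - l"] that by (auto simp: f_def L_def Suc_diff_le)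
    qed (use f1(3) in \<open>auto simp: f_def\<close>)
  qed
  have fwalk: "(f i, f j) \<in> EA ^^ (j - i)" if "i \<le> j" "j \<le> L" for i j
    using walk_segment[of "j - i" f i EA] fstep that by auto
  have L: "L \<le> 2 * r - 2" using yx xz r by (simp add: L_def)
  have fA: "f i \<in> A" if "i \<le> L" for i
    using that fstep[of "i - 1"] f0 D D_subset by (cases i) auto
  have fny: "f j \<noteq> y" if j: "0 < j" "j \<le> L" for j
  proof
    assume y: "f j = y"
    show False
    proof (cases "j \<le> l")
      case True
      then have "r - 1 \<le> l - j" using far[of y x "l - j"] fwalk[of j l] fl y D by (simp add: L_def)
      with True j yx r show False by simp
    next
      case False
      then have "r - 1 \<le> L - j" using far[of y z "L - j"] fwalk[of j L] fL y D j by simp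
      with False j xz r show False by (simp add: L_def)
    qed
  qed
  have bC: "b i \<in> range c" if "i \<le> t" for i
    using that b(1) b(3)[of "i - 1"] by (cases i) auto
  \<comment> \<open>The indices up to \<open>L\<close> follow \<open>f\<close> from \<open>y\<close>
    to \<open>z\<close>; then come the edge to \<open>c (idx z)\<close>, the arc \<open>b\<close>
    and, on wrapping around, the edge from \<open>c (idx y)\<close> back to
    \<open>y\<close>.\<close>
  define c' where "c' = (\<lambda>i. let j = i mod g in if j \<le> L then f j else b (j - Suc L))"
  have Lg: "L + t + 2 = g" using total by (simp add: L_def)
  have c'_step: "(c' i, c' (Suc i)) \<in> E" for i
  proof -
    define j where "j = i mod g"
    have jg: "j < g" using g by (simp add: j_def)
    have Suc: "Suc i mod g = (if Suc j = g then 0 else Suc j)" by (simp add: j_def mod_Suc)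
    consider "j < L" | "j = L" | "j > L" "Suc j < g" | "Suc j = g" using jg by linarith
    then show ?thesis
    proof cases
      case 1
      then show ?thesis using fstep[of j] Lg by (auto simp: c'_def j_def[symmetric] Suc)
    next
      case 2
      then show ?thesis using fL b(1) idx(2)[OF D(4)] Lg by (auto simp: c'_def j_def[symmetric] Suc)
    next
      case 3
      then show ?thesis using b(3)[of "j - Suc L"] Lg
        by (auto simp: c'_def j_def[symmetric] Suc Suc_diff_Suc)
    next
      case 4
      have "(c (idx y), y) \<in> E" using idx(2)[OF D(2)] symE by (meson symD)
      moreover have "j - Suc L = t" using 4 Lg by simp
      ultimately show ?thesis using 4 f0 b(2) Lg by (auto simp: c'_def j_def[symmetric] Suc)
    qed
  qed
  have c'_sub: "range c' \<subseteq> f ` {..L} \<union> range c"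
  proof
    fix v assume "v \<in> range c'"
    then obtain i where i: "v = c' i" by blast
    have "i mod g < g" using g by simp
    then have "i mod g - Suc L \<le> t" using Lg by linarith
    then show "v \<in> f ` {..L} \<union> range c" using bC unfolding i c'_def by (auto simp: Let_def)
  qed
  have c'_f: "f i \<in> range c'" if "i \<le> L" for i
    using that Lg by (auto simp: c'_def intro!: range_eqI[of _ _ i])
  \<comment> \<open>The new walk swallows all of \<open>D\<close>, so what remains of
    \<open>A\<close> has no neighbours on \<open>c\<close>.\<close>
  have D_c': "D \<subseteq> range c'"
    using D(1) c'_f[of 0] c'_f[of l] c'_f[of L] f0 fl fL by (auto simp: L_def)
  define A' where "A' = A - range c'"
  have finA: "finite A" using A(1) fin finite_subset by blast
  have "A' \<subset> A" using D_c' D(2) D_subset by (auto simp: A'_def)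
  then have less: "card A' < card A" using finA by (rule psubset_card_mono[rotated])
  have "A' \<noteq> {}"
  proof -
    have yV: "y \<in> V" using D D_subset A by auto
    \<comment> \<open>Since \<open>3 \<le> k\<close>, the vertex \<open>y\<close> has a neighbour
      other than its two neighbours on the new walk.\<close>
    have "\<exists>w. (y, w) \<in> E \<and> w \<noteq> c (idx y) \<and> w \<noteq> f 1"
    proof (rule ccontr)
      assume "\<not> ?thesis"
      then have "E `` {y} \<subseteq> {c (idx y), f 1}" by blast
      then have "k \<le> card {c (idx y), f 1}" using deg[OF yV] by (metis card_mono finite.emptyI finite.insertI)
      also have "\<dots> \<le> 2" by (simp add: card_insert_if)
      finally show False using k by simp
    qed
    then obtain w where w: "(y, w) \<in> E" "w \<noteq> c (idx y)" "w \<noteq> f 1" by blast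
    have yA: "y \<in> A" using D D_subset by auto
    have wA: "w \<in> A"
      using boundary[OF yA] w unique_exit[OF yA] idx(2)[OF D(2)] by blast
    \<comment> \<open>Otherwise the edge from \<open>w\<close> to \<open>y\<close> would be a chord
      closing an initial part of \<open>f\<close>, and the girth would be at most
      \<open>L + 1 \<le> 2 * r - 1\<close>.\<close>
    have "w \<noteq> f i" if i: "i \<le> L" for i
    proof
      assume wi: "w = f i"
      have "i \<noteq> 0" using wi w(1) f0 irr by metis
      have "(f 0, f (0 + i)) \<in> (E - {(w, y), (y, w)}) ^^ i"
      proof (rule walk_segment)
        fix j assume "j < i"
        then have "(f j, f (Suc j)) \<in> E" "f (Suc j) \<noteq> y" "f j = y \<longrightarrow> j = 0"
          using fstep[of j] fny[of j] fny[of "Suc j"] i by auto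
        then show "(f (0 + j), f (Suc (0 + j))) \<in> E - {(w, y), (y, w)}" using w(3) by auto
      qed
      moreover have "w \<noteq> y" using w(1) irr by auto
      ultimately have "g \<le> i + 1"
        using edge_walk_bound[OF girth symD[OF symE w(1)]] wi f0 by simp
      then show False using i L g r by simp
    qed
    then have "w \<notin> range c'" using c'_sub wA disj by auto
    then show ?thesis using wA by (auto simp: A'_def)
  qed
  moreover have "E `` {v} \<subseteq> A' \<union> range c'" if "v \<in> A'" for v
  proof -
    have "v \<in> A" "v \<notin> D" using that D_c' by (auto simp: A'_def)
    then have "E `` {v} \<subseteq> A" using boundary[of v] unfolding D_def by blast
    then show ?thesis by (auto simp: A'_def)
  qed
  moreover have "c' (i + g) = c' i" for i by (simp add: c'_def)
  moreover have "A' \<subseteq> V" "A' \<inter> range c' = {}" using A by (auto simp: A'_def)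
  ultimately have "separating_walk k g r V E A' c'"
    using graph k g r minimal small less c'_step by unfold_locales (assumption | simp)+
  then show ?thesis using less by blast
qed

text \<open>As the identity does not pack, \<open>R\<close> contains a pair. If \<open>D\<close> has
  a third vertex, it is in a pair as well, since otherwise an exchange would pack. So the pairs link
  up \<open>D\<close> into a path inside \<open>A\<close>, which an arc of \<open>c\<close>
  completes to length \<open>g\<close>.\<close>

lemma smaller_separating_walk: "\<exists>A' c'. separating_walk k g r V E A' c' \<and> card A' < card A"
proof -
  have irrR: "(x, x) \<notin> R" for x by (simp add: R_def)
  have "R \<noteq> {}"
  proof
    assume "R = {}"
    then have "packs D R id" unfolding packs_def by simp
    then show False using no_packing by blast
  qed
  then obtain x y where xy: "(x, y) \<in> R" by auto
  then have D: "x \<in> D" "y \<in> D" "x \<noteq> y" by (auto simp: R_def)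
  have R_arc: "(c (idx u), c (idx v)) \<in> EC ^^ r" if "(u, v) \<in> R" for u v
    using that c_walk[of "idx u" r] c_mod[of "idx u + r"] by (auto simp: R_def)
  show ?thesis
  proof (cases "D \<subseteq> {x, y}")
    case True
    \<comment> \<open>With two vertices, \<open>z\<close> is \<open>x\<close> and the second path is
      empty; the length is \<open>(r - 1) + 0 + r + 2 = g\<close>.\<close>
    have "(y, x) \<in> EA ^^ (r - 1)" using xy relpow_sym[OF sym_EA] unfolding R_def by blast
    then show ?thesis
      using shrink[of x y x "r - 1" 0 r] True D R_arc[OF xy] g r by auto
  next
    case False
    then obtain w where w: "w \<in> D" "w \<noteq> x" "w \<noteq> y" by blast
    have "{x, y, w} = D"
      using card_D w D finite_D by (intro card_seteq) auto
    have tri: ?thesis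
      if abw: "D \<subseteq> {a, b, w}" "(a, b) \<in> R \<union> R\<inverse>" "(a, w) \<in> R \<union> R\<inverse>" "b \<noteq> w" for a b
    proof -
      have ab: "a \<in> D" "b \<in> D" "a \<noteq> b" "a \<noteq> w" "(b, a) \<in> EA ^^ (r - 1)" "(a, w) \<in> EA ^^ (r - 1)"
        using abw relpow_sym[OF sym_EA] by (auto simp: R_def)
      \<comment> \<open>Two shifts by \<open>r\<close> stop one step short of a full turn of length
        \<open>2 * r + 1\<close>, so the exits of \<open>u\<close> and \<open>v\<close> are
        consecutive on \<open>c\<close>.\<close>
      have next_edge: "(c (idx u), c (idx v)) \<in> EC" if "(v, a) \<in> R" "(a, u) \<in> R" for u v
      proof -
        have "idx u = ((idx v + r) mod g + r) mod g" using that unfolding R_def by auto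
        then have "Suc (idx u) mod g = Suc (idx v + 2 * r) mod g"
          by (simp add: mod_simps mult_2 add.assoc)
        also have "Suc (idx v + 2 * r) = idx v + g" using g by simp
        finally have "c (Suc (idx u)) = c (idx v)" by (metis c_mod mod_add_self2)
        then show ?thesis using walk[of "idx u"] by auto
      qed
      \<comment> \<open>As \<open>R\<close> and its converse are single-valued, one of
        \<open>b\<close> and \<open>w\<close> precedes \<open>a\<close> and the other follows
        it.\<close>
      have "(c (idx w), c (idx b)) \<in> EC"
      proof (cases "(a, b) \<in> R")
        case True
        then have "(a, w) \<notin> R" using R_single_valued abw(4) by (meson single_valuedD)
        then have "(c (idx b), c (idx w)) \<in> EC" using next_edge True abw by blast
        then show ?thesis using sym_EC by (meson symD)
      next
        case False
        then have ba: "(b, a) \<in> R" using abw by blast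
        then have "(w, a) \<notin> R" using R_converse_single_valued abw(4) by (meson converseI single_valuedD)
        then show ?thesis using next_edge ba abw by blast
      qed
      then show ?thesis
        using shrink[of a b w "r - 1" "r - 1" 1] abw ab w g r by auto
    qed
    show ?thesis
    proof (cases "w \<in> Field R")
      case False
      \<comment> \<open>With \<open>w\<close> isolated, every pair of \<open>R\<close> consists of
        \<open>x\<close> and \<open>y\<close>.\<close>
      have "packs D R (id(w := x, x := w))"
      proof (rule packs_swap_isolated[OF False w(1) D(1) w(2)])
        fix u v assume uv: "(u, v) \<in> R"
        then have "u \<in> {x, y, w}" "v \<in> {x, y, w}" unfolding \<open>{x, y, w} = D\<close> by (auto simp: R_def)
        then show "u = x \<or> v = x" using uv False irrR by (auto simp: Field_def)
      qed (rule irrR)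
      then show ?thesis using no_packing by blast
    next
      case True
      then obtain u where u: "(w, u) \<in> R \<union> R\<inverse>" by (auto simp: Field_def)
      then have "u \<in> {x, y, w}" unfolding \<open>{x, y, w} = D\<close> by (auto simp: R_def)
      then have "u = x \<or> u = y" using u irrR by auto
      then show ?thesis using tri[of x y] tri[of y x] u xy w \<open>{x, y, w} = D\<close> by blast
    qed
  qed
qed

end

lemma no_separating_walk: "\<not> separating_walk k g r V E A c"
proof
  assume "separating_walk k g r V E A c"
  then show False
  proof (induction "card A" arbitrary: A c rule: less_induct)
    case less
    then show False using separating_walk.smaller_separating_walk by blast
  qed
qed

section \<open>Cages\<close>

lemma pcas_nth:
  assumes "pcas u p v"
  shows "Suc i < length p \<Longrightarrow> snd (p ! i) = fst (p ! Suc i)" and "p \<noteq> [] \<Longrightarrow> fst (hd p) = u \<and> snd (last p) = v"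
    and "pawalk_verts u p = u # map snd p"
  using assms
proof (induction p arbitrary: u i)
  case (Cons e p)
  { case 1 then show ?case using Cons.IH(1)[of "i - 1" "snd e"] Cons.IH(2)[of "snd e"]
      by (cases i; cases p) auto }
  { case 2 then show ?case using Cons.IH(2)[of "snd e"] by (cases p) auto }
  { case 3 then show ?case using Cons.IH(3)[of "snd e"] by auto }
qed auto

lemma pcas_map_upt: "pcas (c a) (map (\<lambda>i. (c i, c (Suc i))) [a..<a + n]) (c (a + n))"
proof (induction n arbitrary: a)
  case (Suc n)
  have "[a..<a + Suc n] = a # [Suc a..<Suc a + n]" by (simp add: upt_conv_Cons del: upt_Suc)
  then show ?case using Suc.IH[of "Suc a"] by (simp del: upt_Suc)
qed simp

lemma simple_cycle_imp_cyc:
  assumes p: "simple_cycle G p"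
  defines "c \<equiv> \<lambda>i. fst (p ! (i mod length p))"
  shows "cyc (parcs G) c (length p)" and "range c = cycle_verts G p"
proof -
  let ?m = "length p"
  obtain u where u: "set p \<subseteq> parcs G" "pcas u p u" "distinct (tl (pawalk_verts u p))" and m3: "3 \<le> ?m"
    using p unfolding simple_cycle_def pre_digraph.cycle_def pre_digraph.awalk_def
    by (auto simp: cas_with_proj_eq awalk_verts_with_proj_eq)
  have ne: "p \<noteq> []" using m3 by auto
  have dist: "distinct (map snd p)" using u pcas_nth(3)[OF u(2)] by simp
  have snd_c: "snd (p ! (i mod ?m)) = c (Suc i)" for i
  proof (cases "Suc (i mod ?m) = ?m")
    case True
    then have "i mod ?m = ?m - 1" by linarith
    then have "snd (p ! (i mod ?m)) = snd (last p)" using ne by (simp add: last_conv_nth)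
    moreover have "c (Suc i) = fst (hd p)" using True ne by (simp add: c_def mod_Suc hd_conv_nth)
    ultimately show ?thesis using pcas_nth(2)[OF u(2) ne] by simp
  next
    case False
    moreover have "i mod ?m < ?m" using ne by simp
    ultimately have "Suc (i mod ?m) < ?m" by linarith
    then show ?thesis using pcas_nth(1)[OF u(2)] False by (simp add: c_def mod_Suc)
  qed
  have step: "(c i, c (Suc i)) \<in> parcs G" for i
  proof -
    have "p ! (i mod ?m) \<in> set p" using ne by simp
    then have "p ! (i mod ?m) \<in> parcs G" using u(1) by blast
    moreover have "p ! (i mod ?m) = (c i, c (Suc i))" using snd_c[of i] by (simp add: c_def prod_eq_iff)
    ultimately show ?thesis by simp
  qed
  have inj: "c i = c j \<longleftrightarrow> i mod ?m = j mod ?m" for i j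
  proof
    assume eq: "c i = c j"
    \<comment> \<open>Distinctness is known for the heads of the arcs, whereas \<open>c\<close>
      lists the tails. The tail at \<open>i\<close> is the head one position earlier;
      \<open>?m\<close> is added so that the subtraction does not truncate.\<close>
    have pre: "Suc (i + ?m - 1) = i + ?m" for i using m3 by simp
    have per: "c (i + ?m) = c i" for i by (simp add: c_def)
    have "snd (p ! ((i + ?m - 1) mod ?m)) = snd (p ! ((j + ?m - 1) mod ?m))"
      unfolding snd_c pre per by (rule eq)
    moreover have "(i + ?m - 1) mod ?m < ?m" for i using ne by simp
    ultimately have "(i + ?m - 1) mod ?m = (j + ?m - 1) mod ?m"
      using dist by (metis distinct_conv_nth length_map nth_map)
    then have "Suc (i + ?m - 1) mod ?m = Suc (j + ?m - 1) mod ?m" by (metis mod_Suc)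
    then show "i mod ?m = j mod ?m" unfolding pre by simp
  qed (simp add: c_def)
  show "cyc (parcs G) c ?m" unfolding cyc_def using m3 step inj by blast
  have "cycle_verts G p = set (u # map snd p)"
    unfolding cycle_verts_def awalk_verts_with_proj_eq
    using pcas_nth(2)[OF u(2) ne] pcas_nth(3)[OF u(2)] by simp
  also have "\<dots> = set (map snd p)"
  proof -
    have "u \<in> set (map snd p)" using pcas_nth(2)[OF u(2) ne] last_in_set[OF ne] by force
    then show ?thesis by auto
  qed
  also have "\<dots> = range c"
  proof
    show "set (map snd p) \<subseteq> range c"
      using snd_c by (auto simp: in_set_conv_nth) (metis mod_less rangeI snd_conv)
    show "range c \<subseteq> set (map snd p)"
    proof
      fix x assume "x \<in> range c"
      then obtain i where i: "x = c i" by blast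
      have "Suc (i + ?m - 1) = i + ?m" using m3 by linarith
      then have "c i = c (Suc (i + ?m - 1))" by (simp add: inj)
      then have "x = snd (p ! ((i + ?m - 1) mod ?m))" using i snd_c by simp
      then show "x \<in> set (map snd p)" using ne by simp
    qed
  qed
  finally show "range c = cycle_verts G p" by simp
qed

lemma cyc_imp_simple_cycle:
  assumes G: "pair_graph G" and c: "cyc (parcs G) c m"
  shows "\<exists>p. simple_cycle G p \<and> length p = m"
proof -
  interpret pair_graph G by fact
  let ?p = "map (\<lambda>i. (c i, c (Suc i))) [0..<m]"
  have m3: "3 \<le> m" and step: "\<And>i. (c i, c (Suc i)) \<in> parcs G"
    and inj: "\<And>i j. c i = c j \<longleftrightarrow> i mod m = j mod m"
    using c unfolding cyc_def by auto
  have "c m = c 0" unfolding inj by simp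
  then have cas: "pcas (c 0) ?p (c 0)" using pcas_map_upt[of c 0 m] by simp
  have "inj_on (\<lambda>i. c (Suc i)) {0..<m}"
  proof (rule inj_onI)
    fix i j assume ij: "i \<in> {0..<m}" "j \<in> {0..<m}" "c (Suc i) = c (Suc j)"
    then have "Suc i mod m = Suc j mod m" unfolding inj by blast
    then show "i = j" using ij by (auto simp: mod_Suc split: if_splits)
  qed
  then have "distinct (map snd ?p)" by (simp add: distinct_map comp_def)
  moreover have "c 0 \<in> pverts G" using step in_arcsD1 by blast
  ultimately have "simple_cycle G ?p"
    unfolding simple_cycle_def pre_digraph.cycle_def pre_digraph.awalk_def
    using cas m3 step pcas_nth(3)[OF cas]
    by (auto simp: cas_with_proj_eq awalk_verts_with_proj_eq intro!: exI[of _ "c 0"])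
  then show ?thesis by (intro exI[of _ ?p]) simp
qed

lemma out_degree_eq_card_Image: "out_degree (with_proj G) v = card (parcs G `` {v})"
proof -
  have "out_arcs (with_proj G) v = Pair v ` (parcs G `` {v})" by (auto simp: out_arcs_def)
  then show ?thesis unfolding out_degree_def by (simp add: card_image inj_on_def)
qed

lemma kg_graph_imp_kgraph:
  assumes "kg_graph k g G" shows "kgraph k g (pverts G) (parcs G)"
proof -
  have G: "pair_graph G" and deg: "regular_graph k G" and girth: "girth G = enat g"
    using assms unfolding kg_graph_def by auto
  interpret pair_graph G by fact
  have "girth_ge (parcs G) g"
    unfolding girth_ge_def
  proof (intro allI impI)
    fix c m assume "cyc (parcs G) c m"
    then obtain p where "simple_cycle G p" "length p = m" using cyc_imp_simple_cycle[OF G] by blast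
    then have "girth G \<le> enat m" unfolding girth_def by (auto intro: INF_lower2)
    then show "g \<le> m" using girth by simp
  qed
  moreover have "sym (parcs G)" using arcs_symmetric by (auto intro: symI)
  moreover have "irrefl (parcs G)" using pair_no_loops by (fastforce simp: irrefl_def)
  ultimately show ?thesis
    using deg pair_finite_verts in_arcsD1 in_arcsD2
    by (auto simp: kgraph_def regular_graph_def out_degree_eq_card_Image)
qed

text \<open>The failure of the bound \<open>Suc g\<close> supplies a cycle of length exactly
  \<open>g\<close>.\<close>

lemma kgraph_imp_kg_graph:
  assumes G: "kgraph k g V E" and short: "\<not> girth_ge E (Suc g)"
  shows "kg_graph k g \<lparr>pverts = V, parcs = E\<rparr>" (is "kg_graph k g ?G")
proof -
  have fin: "finite V" and EV: "E \<subseteq> V \<times> V" and symE: "sym E" and irr: "irrefl E"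
    and deg: "\<And>v. v \<in> V \<Longrightarrow> card (E `` {v}) = k" and girth: "girth_ge E g"
    using G unfolding kgraph_def by auto
  have "finite E" using EV fin by (meson finite_SigmaI finite_subset)
  then have pg: "pair_graph ?G"
    using EV fin irr symE by unfold_locales (auto simp: symmetric_def irrefl_def)
  obtain c m where "cyc E c m" "m \<le> g" using short unfolding girth_ge_def by (auto simp: not_less_eq_eq)
  moreover from this have "m = g" using girth unfolding girth_ge_def by (simp add: le_antisym)
  ultimately obtain p where p: "simple_cycle ?G p" "length p = g"
    using cyc_imp_simple_cycle[OF pg, of c g] by auto
  have "girth ?G = enat g"
    unfolding girth_def
  proof (rule antisym)
    show "(INF p\<in>{p. simple_cycle ?G p}. enat (length p)) \<le> enat g" using p by (auto intro: INF_lower2)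
    show "enat g \<le> (INF p\<in>{p. simple_cycle ?G p}. enat (length p))"
    proof (rule INF_greatest)
      fix q assume "q \<in> {p. simple_cycle ?G p}"
      then have "cyc E (\<lambda>i. fst (q ! (i mod length q))) (length q)"
        using simple_cycle_imp_cyc(1)[of ?G q] by simp
      then show "enat g \<le> enat (length q)" using girth unfolding girth_ge_def by simp
    qed
  qed
  then show ?thesis
    using pg deg by (simp add: kg_graph_def regular_graph_def out_degree_eq_card_Image)
qed

text \<open>Moves a graph on another vertex type, such as the doubled one, to the natural numbers,
  where the competitors in \<open>kg_cage\<close> live.\<close>

lemma kgraph_image:
  assumes G: "kgraph k g V E" and f: "inj_on f V"
  shows "kgraph k g (f ` V) (map_prod f f ` E)"
proof -
  have fin: "finite V" and EV: "E \<subseteq> V \<times> V" and symE: "sym E" and irr: "irrefl E"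
    and deg: "\<And>v. v \<in> V \<Longrightarrow> card (E `` {v}) = k" and girth: "girth_ge E g"
    using G unfolding kgraph_def by auto
  have iff: "(f x, f y) \<in> map_prod f f ` E \<longleftrightarrow> (x, y) \<in> E" if "x \<in> V" "y \<in> V" for x y
    using inj_on_image_mem_iff[OF map_prod_inj_on[OF f f], of "(x, y)" E] EV that by simp
  have "card ((map_prod f f ` E) `` {f v}) = k" if v: "v \<in> V" for v
  proof -
    have "(map_prod f f ` E) `` {f v} = f ` (E `` {v})"
    proof
      show "(map_prod f f ` E) `` {f v} \<subseteq> f ` (E `` {v})"
      proof
        fix z assume "z \<in> (map_prod f f ` E) `` {f v}"
        then obtain x y where xy: "(x, y) \<in> E" "f x = f v" "z = f y" by auto
        moreover from this have "x = v" using f v EV by (meson inj_onD mem_Sigma_iff subsetD)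
        ultimately show "z \<in> f ` (E `` {v})" by blast
      qed
    qed force
    moreover have "inj_on f (E `` {v})" by (rule inj_on_subset[OF f]) (use EV in auto)
    ultimately show ?thesis using deg[OF v] by (simp add: card_image)
  qed
  moreover have "girth_ge (map_prod f f ` E) g"
    unfolding girth_ge_def
  proof (intro allI impI)
    fix c m assume c: "cyc (map_prod f f ` E) c m"
    define c' where "c' = (\<lambda>i. inv_into V f (c i))"
    have st: "(c i, c (Suc i)) \<in> map_prod f f ` E" for i using c unfolding cyc_def by blast
    then have cV: "c i \<in> f ` V" for i using EV by fastforce
    have "c' i \<in> V" and fc': "f (c' i) = c i" for i
      unfolding c'_def using cV by (auto intro: inv_into_into f_inv_into_f)
    then have "(c' i, c' (Suc i)) \<in> E" for i using st[of i] iff[of "c' i" "c' (Suc i)"] by simp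
    moreover have "c' i = c' j \<longleftrightarrow> c i = c j" for i j using fc' by (metis c'_def)
    ultimately have "cyc E c' m" using c unfolding cyc_def by simp
    then show "g \<le> m" using girth unfolding girth_ge_def by blast
  qed
  moreover have "sym (map_prod f f ` E)" using symE by (fastforce simp: sym_def)
  moreover have "irrefl (map_prod f f ` E)"
    using irr EV f by (auto simp: irrefl_def inj_on_def)
  moreover have "map_prod f f ` E \<subseteq> f ` V \<times> f ` V" using EV by auto
  ultimately show ?thesis using fin by (auto simp: kgraph_def)
qed

text \<open>Hence competitors of a cage need only have girth at least \<open>g\<close>.\<close>

lemma kg_cage_card_le:
  assumes cage: "kg_cage k g G" and k: "3 \<le> k" and g: "3 \<le> g"
    and W: "kgraph k g W F" and ne: "W \<noteq> {}"
  shows "card (pverts G) \<le> card W"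
proof -
  let ?P = "\<lambda>n. \<exists>(V :: nat set) E. kgraph k g V E \<and> V \<noteq> {} \<and> card V = n"
  have "finite W" using W unfolding kgraph_def by blast
  then obtain f :: "'b \<Rightarrow> nat" where f: "inj_on f W"
    using finite_imp_inj_to_nat_seg[of W] by auto
  then have PW: "?P (card W)" using kgraph_image[OF W f] ne card_image[OF f] by blast
  then have "?P (Least ?P)" by (rule LeastI)
  then obtain V :: "nat set" and E where V: "kgraph k g V E" "V \<noteq> {}" "card V = Least ?P" by blast
  \<comment> \<open>A graph of least order with girth at least \<open>g\<close> has girth exactly
    \<open>g\<close>: a larger girth would allow a still smaller order.\<close>
  have "\<not> kgraph k (Suc g) V E"
  proof
    assume "kgraph k (Suc g) V E"
    from smaller_girth_smaller_order[OF this k g V(2)]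
    obtain V' :: "nat set" and E' where "kgraph k g V' E'" "V' \<noteq> {}" "card V' < Least ?P"
      using V(3) by auto
    then show False using not_less_Least[of "card V'" ?P] by blast
  qed
  then have "\<not> girth_ge E (Suc g)" using V(1) unfolding kgraph_def by blast
  from kgraph_imp_kg_graph[OF V(1) this] have "card (pverts G) \<le> card V"
    using cage unfolding kg_cage_def by fastforce
  also have "\<dots> \<le> card W" using Least_le[of ?P, OF PW] V(3) by simp
  finally show ?thesis .
qed

text \<open>A third neighbour of \<open>c 0\<close> cannot lie on the cycle, where it would give a
  chord and a shorter cycle. The lemma is needed because \<open>connected\<close> demands a nonempty
  vertex set.\<close>

lemma girth_cycle_not_spanning:
  assumes G: "kgraph k g V E" and k: "3 \<le> k" and c: "cyc E c g"
  shows "\<exists>w \<in> V. w \<notin> range c"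
proof -
  have EV: "E \<subseteq> V \<times> V" and irr: "\<And>v. (v, v) \<notin> E" and deg: "\<And>v. v \<in> V \<Longrightarrow> card (E `` {v}) = k"
    and girth: "girth_ge E g" and symE: "sym E"
    using G unfolding kgraph_def irrefl_def by auto
  have g3: "3 \<le> g" and step: "\<And>i. (c i, c (Suc i)) \<in> E"
    and inj: "\<And>i j. c i = c j \<longleftrightarrow> i mod g = j mod g"
    using c unfolding cyc_def by auto
  have "\<exists>w. (c 0, w) \<in> E \<and> w \<noteq> c 1 \<and> w \<noteq> c (g - 1)"
  proof (rule ccontr)
    assume "\<not> ?thesis"
    then have "E `` {c 0} \<subseteq> {c 1, c (g - 1)}" by blast
    then have "card (E `` {c 0}) \<le> card {c 1, c (g - 1)}" by (intro card_mono) auto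
    also have "\<dots> \<le> 2" by (simp add: card_insert_if)
    finally show False using deg[of "c 0"] step[of 0] EV k by auto
  qed
  then obtain w where w: "(c 0, w) \<in> E" "w \<noteq> c 1" "w \<noteq> c (g - 1)" by blast
  have "w \<noteq> c i" for i
  proof
    assume "w = c i"
    then have wj: "w = c (i mod g)" unfolding inj by (metis inj mod_mod_trivial)
    define j where "j = i mod g"
    have wj: "w = c j" and "j < g" using wj g3 by (auto simp: j_def)
    have "j \<noteq> 0" using w(1) wj irr by (cases "j = 0") auto
    moreover have "j \<noteq> 1" "j \<noteq> g - 1" using w(2,3) wj by auto
    ultimately have j: "j \<noteq> 0" "j \<noteq> 1" "j < g - 1" using \<open>j < g\<close> by auto
    have "(c 0, c (0 + j)) \<in> (E - {(w, c 0), (c 0, w)}) ^^ j"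
    proof (rule walk_segment)
      fix n assume n: "n < j"
      have "c n = c 0 \<longrightarrow> n = 0" "c n \<noteq> w" "c (Suc n) \<noteq> c 0"
        using n j wj by (auto simp: inj)
      then show "(c (0 + n), c (Suc (0 + n))) \<in> E - {(w, c 0), (c 0, w)}"
        using step[of n] w(2) by auto
    qed
    moreover have "w \<noteq> c 0" using w(1) irr by auto
    ultimately have "g \<le> j + 1"
      using edge_walk_bound[OF girth symD[OF symE w(1)]] wj by simp
    then show False using j by simp
  qed
  then show ?thesis using w(1) EV by auto
qed

theorem theorem4:
  fixes k g :: nat and G :: "'a pair_pre_digraph"
  assumes "k \<ge> 3"
    and "g \<ge> 5" and "odd g"
    and "kg_cage k g G"
  shows "\<forall>p. simple_cycle G p \<and> length p = g \<longrightarrow> nonseparating G p"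
proof (intro allI impI)
  fix p assume p: "simple_cycle G p \<and> length p = g"
  define V where "V = pverts G"
  define E where "E = parcs G"
  have graph: "kgraph k g V E"
    using assms(4) kg_graph_imp_kgraph unfolding kg_cage_def V_def E_def by blast
  have finV: "finite V" and symE: "sym E" and EV: "E \<subseteq> V \<times> V"
    using graph unfolding kgraph_def by auto
  obtain c where c: "cyc E c g" "range c = cycle_verts G p"
    using simple_cycle_imp_cyc[of G p] p unfolding E_def by auto
  obtain r where r: "g = 2 * r + 1" using assms(3) by (rule oddE)
  define S where "S = V - range c"
  \<comment> \<open>\<open>connected\<close> means strong connectivity of this symmetric closure,
    which adds no arcs because \<open>E\<close> is symmetric.\<close>
  define H where "H = mk_symmetric (with_proj G \<restriction> S)"
  have H: "verts (with_proj H) = S" "arcs_ends (with_proj H) = E \<inter> S \<times> S"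
    using symD[OF symE]
    by (auto simp: H_def mk_symmetric_def induce_subgraph_def E_def[symmetric])
  show "nonseparating G p"
  proof (rule ccontr)
    assume "\<not> nonseparating G p"
    moreover have "S \<noteq> {}"
      using girth_cycle_not_spanning[OF graph assms(1) c(1)] by (auto simp: S_def)
    ultimately obtain u v where uv: "u \<in> S" "v \<in> S" "(u, v) \<notin> rtrancl_on S (E \<inter> S \<times> S)"
      unfolding nonseparating_def connected_def strongly_connected_def reachable_def
        H_def[symmetric] c(2)[symmetric] V_def[symmetric] S_def[symmetric] H
      by blast
    \<comment> \<open>The component of \<open>u\<close> in \<open>G - V(C)\<close>. Both
      \<open>B\<close> and \<open>S - B\<close> are closed under adjacency in \<open>S\<close>, and
      the smaller one plays the part of \<open>A\<close>.\<close>
    define B where "B = {w. (u, w) \<in> rtrancl_on S (E \<inter> S \<times> S)}"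
    have BS: "B \<subseteq> S" unfolding B_def by (auto elim: rtrancl_on.cases)
    have ind: "False" if A: "A \<subseteq> S" "A \<noteq> {}" "2 * card A \<le> card S"
      and closed: "\<And>x y. x \<in> A \<Longrightarrow> (x, y) \<in> E \<Longrightarrow> y \<in> S \<Longrightarrow> y \<in> A" for A
    proof -
      have "c 0 \<in> V" using c(1) EV unfolding cyc_def by auto
      then have "S \<subset> V" unfolding S_def by blast
      then have "card S < card V" using finV by (rule psubset_card_mono[rotated])
      moreover have "c (i + g) = c i" for i using c(1) unfolding cyc_def by simp
      moreover have "card V \<le> card W"
        if "kgraph k g W F" "W \<noteq> {}" for W :: "('a \<times> bool) set" and F
        using kg_cage_card_le[OF assms(4,1) _ that] assms(2) by (simp add: V_def)
      moreover have "(c i, c (Suc i)) \<in> E" for i using c(1) unfolding cyc_def by blast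
      moreover have "E `` {x} \<subseteq> A \<union> range c" if "x \<in> A" for x
        using closed[OF that] EV by (auto simp: S_def)
      moreover have "A \<subseteq> V" "A \<inter> range c = {}" using A(1) by (auto simp: S_def)
      ultimately have "separating_walk k g r V E A c"
        using graph assms(1,2) r A(2,3) by unfold_locales (assumption | simp)+
      then show False using no_separating_walk by blast
    qed
    have Bstep: "y \<in> B" if "x \<in> B" "(x, y) \<in> E" "y \<in> S" for x y
      using that BS unfolding B_def by (auto intro: rtrancl_on_into_rtrancl_on)
    have "u \<in> B" "v \<in> S - B" using uv by (auto simp: B_def)
    have cards: "card S = card B + card (S - B)"
      using BS finV by (simp add: S_def card_Diff_subset finite_subset card_mono)
    have co_step: "y \<in> S - B" if "x \<in> S - B" "(x, y) \<in> E" "y \<in> S" for x y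
      using Bstep[of y x] that symD[OF symE that(2)] by blast
    show False
    proof (cases "card B \<le> card (S - B)")
      case True
      show False
        by (rule ind[OF BS _ _ Bstep]) (use True \<open>u \<in> B\<close> cards in auto)
    next
      case False
      show False
        by (rule ind[OF Diff_subset _ _ co_step]) (use False \<open>v \<in> S - B\<close> cards in auto)
    qed
  qed
qed

end
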